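(* Let $I\in J(\mathcal{P})_\lambda$ with $\max I=\{(s_i,\lambda_i)\mid i\in S\}$, $S=\{i_1<\dots<i_t\}$, $t\ge1$. Let $\mathcal{O}_{m',J,K}\subset R_\lambda^{I^*}$ be a $G_\lambda^I$-orbit, let $r_i$ and $x$ be the associated exponents and characteristic element, and let $y_{i_1},\dots,y_{i_t}\in R^*$ be such that $f=((\pi^{s_{i_1}}y_{i_1},\dots,\pi^{s_{i_t}}y_{i_t}),x)\in\mathcal{O}_{m',J,K}$. Let $\mathcal{O}=\{(g\,e(I),gf)\mid g\in G_\lambda\}\subset R_\lambda^{I^*}\times R_\lambda^{I^*}$. For $1\le l\le t$ let $$\begin{aligned}m_{i_l}=\min\Big(&\min_{j<i_l,\,j\in S}(s_j+val(y_j-y_{i_l})),\ \min_{j>i_l,\,j\in S}(\lambda_{i_l}-\lambda_j+s_j+val(y_j-y_{i_l})),\\&\min_{j<i_l,\,j\in S,\,\rho_j>1}r_j,\ \min_{j<i_l,\,j\notin S}r_j,\\&\min_{j>i_l,\,j\in S,\,\rho_j>1}(\lambda_{i_l}-\lambda_j+r_j),\ \min_{j>i_l,\,j\notin S}(\lambda_{i_l}-\lambda_j+r_j)\Big).\end{aligned}$$ Then for every $(\underline a,\underline b)\in\mathcal{O}$ and every $1\le l\le t$, the $i_l$-th block components $a_{i_l},b_{i_l}$ of $\underline a,\underline b$ satisfy: 1. $a_{i_l},b_{i_l}\in\pi^{s_{i_l}}R_{\lambda_{i_l}}^{\rho_{i_l}*}$. 2. $m_{i_l}>s_{i_l}$,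 and exactly one of the following holds: A. ($m_{i_l}\le r_{i_l}$ and $\rho_{i_l}>1$) or $\rho_{i_l}=1$, and $b_{i_l}-y_{i_l}a_{i_l}\in\pi^{m_{i_l}}R_{\lambda_{i_l}}^{\rho_{i_l}}$; B. $m_{i_l}>r_{i_l}$ and $\rho_{i_l}>1$, and $b_{i_l}-y_{i_l}a_{i_l}\in\pi^{r_{i_l}}R_{\lambda_{i_l}}^{\rho_{i_l}}$ with $\pi^{-r_{i_l}}(b_{i_l}-y_{i_l}a_{i_l})\ (\mathrm{mod}\ \pi)$ linearly independent with $\pi^{-s_{i_l}}a_{i_l}\ (\mathrm{mod}\ \pi)$ in $\mathbb{F}_q^{\rho_{i_l}}$.
   Context: Let $R$ be a discrete valuation ring with uniformizer $\pi$, finite residue field $\mathbb{F}_q$ and unit group $R^*$; $val$ is the valuation on $R$, $val(0)=\infty$, $\pi^\infty:=0$, and a minimum over an empty set is $\infty$. Write $R_n=R/\pi^nR$, $R_n^{\rho*}=R_n^\rho\setminus\pi R_n^\rho$ and $\pi^jR_n^{\rho*}=\pi^jR_n^\rho\setminus\pi^{j+1}R_n^\rho$. For $z\in\pi^rR_n^\rho$ with $r<n$, $\pi^{-r}z\ (\mathrm{mod}\ \pi)\in\mathbb{F}_q^\rho$ is the reduction of any $w$ with $\pi^rw=z$. For $\lambda=(\lambda_1^{\rho_1}>\dots>\lambda_k^{\rho_k})$ (positive integers $\lambda_1>\dots>\lambda_k$, multiplicities $\rho_i\ge1$) put $R_\lambda=\bigoplus_{i=1}^kR_{\lambda_i}^{\rho_i}$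 and $G_\lambda=\mathrm{Aut}_R(R_\lambda)$. An element $\underline a\in R_\lambda$ has block components $a_i\in R_{\lambda_i}^{\rho_i}$. The fundamental poset is $\mathcal{P}=\{(v,l)\mid l\in\mathbb{N},\,0\le v<l\}$ with $(v,l)\le(v',l')$ iff $v\ge v'$ and $l-v\le l'-v'$. Order ideals are down-closed subsets; $\max(I)$ is the set of maximal elements of $I$. For an element $e$ of a finite $R$-module $M$, fix an isomorphism $M\cong\bigoplus_i(R/\pi^{\mu_i}R)^{\sigma_i}$ ($\mu_i$ distinct); $I(e)$ is the order ideal generated by the pairs $(v_i,\mu_i)$, where $v_i$ is the minimum of the valuations of the coordinates of $e$ in the $i$-th block, over the blocks where $e$ is non-zero ($I(e)$ does not depend on the isomorphism; $I(0)=\emptyset$). For an order ideal $I$ put $M^I=\{e\in M\mid I(e)\subset I\}$ and $M^{I^*}=\{e\in M\mid I(e)=I\}$. $J(\mathcal{P})_\lambda$ is the set of order ideals $I$ all of whose maximal elements are of the form $(v,\lambda_i)$; the sets $R_\lambda^{I^*}$, $I\in J(\mathcal{P})_\lambda$, are exactly the $G_\lambda$-orbits of $R_\lambda$. Given $I$ with $\max I=\{(s_i,\lambda_i)\mid i\in S\}$: the canonical form $e(I)\in R_\lambda^{I^*}$ has first coordinate $\pi^{s_i}$ in the block $R_{\lambda_i}^{\rho_i}$ for each $i\in S$, and all other coordinates $0$; $G_\lambda^I$ is its stabilizer in $G_\lambda$. $R_{\lambda'}\cong\bigoplus_{i\in S}R_{\lambda_i}$ is the direct sum of the first cyclic summands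 of the blocks $i\in S$, $R_{\lambda''}$ is the direct sum of all remaining cyclic summands; elements of $R_\lambda=R_{\lambda'}\oplus R_{\lambda''}$ are written $m=(m',m'')$ (up to permuting coordinates), and $e(I)'$ is the projection of $e(I)$ to $R_{\lambda'}$. For $m=(m',m'')\in R_\lambda^{I^*}$ let $\bar m'$ be the image of $m'$ in $R_{\lambda'}/R\,e(I)'$, $J=I(\bar m')$, $K=I(m'')$; then $$\mathcal{O}_{m',J,K}=\{(l',l'')\mid l'\in m'+R_{\lambda'}^{J\cup K},\ l''\in R_{\lambda''}^{K^*}+R_{\lambda''}^{J}\}$$ is the $G_\lambda^I$-orbit of $m$ (known), and every $G_\lambda^I$-orbit in $R_\lambda^{I^*}$ is of this form. Put $r_i=\min\{v\mid(v,\lambda_i)\in J\cup K\}$ ($\infty$ if there is no such $v$). The characteristic element $x\in R_{\lambda''}$ has block $\pi^{r_i}(1,0,\dots,0)\in R_{\lambda_i}^{\rho_i}$ for $i\notin S$ and block $\pi^{r_i}(1,0,\dots,0)\in R_{\lambda_i}^{\rho_i-1}$ for $i\in S$, $\rho_i>1$ (there is no block in $R_{\lambda''}$ for $i\in S$, $\rho_i=1$). Thus the blocks of $f$ are $f_i=(\pi^{s_i}y_i,\pi^{r_i},0,\dots,0)$ for $i\in S$, $\rho_i>1$; $f_i=\pi^{s_i}y_i$ for $i\in S$, $\rho_i=1$; $f_i=(\pi^{r_i},0,\dots,0)$ for $i\notin S$. *)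

theory Defs
  imports "HOL-Algebra.Group_Action" "HOL-Algebra.Module" "HOL-Algebra.Ring_Divisibility" "HOL-Library.Extended_Nat"
begin

section \<open>Discrete valuation rings\<close>

locale discrete_valuation_ring = principal_domain R for R (structure) +
  assumes unique_nonzero_prime: "\<exists>!P. primeideal P R \<and> P \<noteq> {\<zero>}"

definition uniformizer :: "('a, 'b) ring_scheme \<Rightarrow> 'a \<Rightarrow> bool" where
  "uniformizer R \<pi> \<longleftrightarrow> \<pi> \<in> carrier R \<and> maximalideal (PIdl\<^bsub>R\<^esub> \<pi>) R"

definition residue_field :: "('a, 'b) ring_scheme \<Rightarrow> 'a \<Rightarrow> 'a set ring" where
  "residue_field R \<pi> = R Quot (PIdl\<^bsub>R\<^esub> \<pi>)"

definition val :: "('a, 'b) ring_scheme \<Rightarrow> 'a \<Rightarrow> 'a \<Rightarrow> enat" where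
  "val R \<pi> x =
     (if x = \<zero>\<^bsub>R\<^esub> then \<infinity> else enat (THE n. \<exists>u \<in> Units R. x = u \<otimes>\<^bsub>R\<^esub> \<pi> [^]\<^bsub>R\<^esub> n))"

definition epow :: "('a, 'b) ring_scheme \<Rightarrow> 'a \<Rightarrow> enat \<Rightarrow> 'a" where
  "epow R \<pi> m = (case m of enat n \<Rightarrow> \<pi> [^]\<^bsub>R\<^esub> n | \<infinity> \<Rightarrow> \<zero>\<^bsub>R\<^esub>)"

section \<open>Modules\<close>

text \<open>The fields \<^const>\<open>monoid.mult\<close> and \<^const>\<open>one\<close> of a module record have no meaning for a module
  and are left undefined, except for \<open>cyc\<close>, which is also a ring.\<close>

definition cyc :: "('a, 'b) ring_scheme \<Rightarrow> 'a \<Rightarrow> nat \<Rightarrow> ('a, 'a set) module" where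
  "cyc R \<pi> n =
     (let I = PIdl\<^bsub>R\<^esub> (\<pi> [^]\<^bsub>R\<^esub> n); Q = R Quot I in
      \<lparr>carrier = carrier Q, monoid.mult = monoid.mult Q, one = one Q,
       ring.zero = ring.zero Q, ring.add = ring.add Q,
       smult = (\<lambda>r C. (I +>\<^bsub>R\<^esub> r) \<otimes>\<^bsub>Q\<^esub> C)\<rparr>)"

definition cls :: "('a, 'b) ring_scheme \<Rightarrow> 'a \<Rightarrow> nat \<Rightarrow> 'a \<Rightarrow> 'a set" where
  "cls R \<pi> n x = PIdl\<^bsub>R\<^esub> (\<pi> [^]\<^bsub>R\<^esub> n) +>\<^bsub>R\<^esub> x"

definition direct_sum :: "'i set \<Rightarrow> ('i \<Rightarrow> ('a, 'm) module) \<Rightarrow> ('a, 'i \<Rightarrow> 'm) module" where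
  "direct_sum A M =
     \<lparr>carrier = (\<Pi>\<^sub>E i\<in>A. carrier (M i)), monoid.mult = undefined, one = undefined,
      ring.zero = (\<lambda>i\<in>A. \<zero>\<^bsub>M i\<^esub>),
      ring.add = (\<lambda>x y. \<lambda>i\<in>A. x i \<oplus>\<^bsub>M i\<^esub> y i),
      smult = (\<lambda>r x. \<lambda>i\<in>A. r \<odot>\<^bsub>M i\<^esub> x i)\<rparr>"

definition quot_module ::
  "('a, 'm) module \<Rightarrow> 'm set \<Rightarrow> ('a, 'm set) module" where
  "quot_module M N =
     \<lparr>carrier = a_rcosets\<^bsub>M\<^esub> N, monoid.mult = undefined, one = undefined,
      ring.zero = N, ring.add = set_add M,
      smult = (\<lambda>r C. \<Union>x\<in>C. N +>\<^bsub>M\<^esub> (r \<odot>\<^bsub>M\<^esub> x))\<rparr>"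

definition cyclic_submodule :: "('a, 'b) ring_scheme \<Rightarrow> ('a, 'm) module \<Rightarrow> 'm \<Rightarrow> 'm set" where
  "cyclic_submodule R M e = {r \<odot>\<^bsub>M\<^esub> e | r. r \<in> carrier R}"

definition module_iso ::
  "('a, 'b) ring_scheme \<Rightarrow> ('a, 'm) module \<Rightarrow> ('a, 'n) module \<Rightarrow> ('m \<Rightarrow> 'n) set" where
  "module_iso R M N =
     {f \<in> iso (add_monoid M) (add_monoid N).
        \<forall>r\<in>carrier R. \<forall>x\<in>carrier M. f (r \<odot>\<^bsub>M\<^esub> x) = r \<odot>\<^bsub>N\<^esub> f x}"

definition module_Aut ::
  "('a, 'b) ring_scheme \<Rightarrow> ('a, 'm) module \<Rightarrow> ('m \<Rightarrow> 'm) monoid" where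
  "module_Aut R M =
     AutoGroup (add_monoid M)
       \<lparr>carrier := {f \<in> auto (add_monoid M).
          \<forall>r\<in>carrier R. \<forall>x\<in>carrier M. f (r \<odot>\<^bsub>M\<^esub> x) = r \<odot>\<^bsub>M\<^esub> f x}\<rparr>"

text \<open>Partitions are given by functions on the block numbers \<open>{1..k}\<close>: \<open>lam i\<close> is the \<open>i\<close>-th part
  and \<open>\<rho> i\<close> its multiplicity. The cyclic summands of \<open>R\<^sub>\<lambda>\<close> are indexed by pairs \<open>(i, c)\<close>,
  where \<open>i\<close> is the block and \<open>c\<close> the position in the block.\<close>

definition is_partition :: "nat \<Rightarrow> (nat \<Rightarrow> nat) \<Rightarrow> (nat \<Rightarrow> nat) \<Rightarrow> bool" where
  "is_partition k lam \<rho> \<longleftrightarrow>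
     (\<forall>i\<in>{1..k}. lam i \<ge> 1 \<and> \<rho> i \<ge> 1) \<and> (\<forall>i\<in>{1..k}. \<forall>j\<in>{1..k}. i < j \<longrightarrow> lam j < lam i)"

definition idx :: "nat \<Rightarrow> (nat \<Rightarrow> nat) \<Rightarrow> (nat \<times> nat) set" where
  "idx k \<rho> = (SIGMA i:{1..k}. {1..\<rho> i})"

definition cyc_sum ::
  "('a, 'b) ring_scheme \<Rightarrow> 'a \<Rightarrow> (nat \<Rightarrow> nat) \<Rightarrow> (nat \<times> nat) set \<Rightarrow>
    ('a, nat \<times> nat \<Rightarrow> 'a set) module" where
  "cyc_sum R \<pi> lam A = direct_sum A (\<lambda>(i, c). cyc R \<pi> (lam i))"

definition R_lam ::
  "('a, 'b) ring_scheme \<Rightarrow> 'a \<Rightarrow> nat \<Rightarrow> (nat \<Rightarrow> nat) \<Rightarrow> (nat \<Rightarrow> nat) \<Rightarrow>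
    ('a, nat \<times> nat \<Rightarrow> 'a set) module" where
  "R_lam R \<pi> k lam \<rho> = cyc_sum R \<pi> lam (idx k \<rho>)"

definition cyc_power ::
  "('a, 'b) ring_scheme \<Rightarrow> 'a \<Rightarrow> nat \<Rightarrow> nat \<Rightarrow> ('a, nat \<Rightarrow> 'a set) module" where
  "cyc_power R \<pi> n r = direct_sum {1..r} (\<lambda>_. cyc R \<pi> n)"

definition block :: "(nat \<Rightarrow> nat) \<Rightarrow> nat \<Rightarrow> (nat \<times> nat \<Rightarrow> 'x) \<Rightarrow> nat \<Rightarrow> 'x" where
  "block \<rho> i a = (\<lambda>c\<in>{1..\<rho> i}. a (i, c))"

definition pi_mult ::
  "('a, 'b) ring_scheme \<Rightarrow> 'a \<Rightarrow> enat \<Rightarrow> ('a, 'm) module \<Rightarrow> 'm set" where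
  "pi_mult R \<pi> m M = (\<lambda>z. epow R \<pi> m \<odot>\<^bsub>M\<^esub> z) ` carrier M"

definition pi_mult_star ::
  "('a, 'b) ring_scheme \<Rightarrow> 'a \<Rightarrow> nat \<Rightarrow> ('a, 'm) module \<Rightarrow> 'm set" where
  "pi_mult_star R \<pi> j M = pi_mult R \<pi> (enat j) M - pi_mult R \<pi> (enat (Suc j)) M"

section \<open>Reduction and linear independence over the residue field\<close>

text \<open>\<open>PIdl \<pi> <+> C\<close> is the coset of \<open>\<pi>R\<close> containing the coset \<open>C\<close> of \<open>\<pi>\<^sup>nR\<close>, \<open>n \<ge> 1\<close>.\<close>

definition div_reduce ::
  "('a, 'b) ring_scheme \<Rightarrow> 'a \<Rightarrow> nat \<Rightarrow> nat \<Rightarrow> nat \<Rightarrow> (nat \<Rightarrow> 'a set) \<Rightarrow> nat \<Rightarrow> 'a set" where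
  "div_reduce R \<pi> n r v z =
     (let M = cyc_power R \<pi> n r;
          w = (SOME w. w \<in> carrier M \<and> (\<pi> [^]\<^bsub>R\<^esub> v) \<odot>\<^bsub>M\<^esub> w = z)
      in (\<lambda>c\<in>{1..r}. PIdl\<^bsub>R\<^esub> \<pi> <+>\<^bsub>R\<^esub> w c))"

definition lin_indep2 ::
  "('f, 'b) ring_scheme \<Rightarrow> nat \<Rightarrow> (nat \<Rightarrow> 'f) \<Rightarrow> (nat \<Rightarrow> 'f) \<Rightarrow> bool" where
  "lin_indep2 F r u w \<longleftrightarrow>
     (\<forall>\<alpha>\<in>carrier F. \<forall>\<beta>\<in>carrier F.
        (\<forall>c\<in>{1..r}. \<alpha> \<otimes>\<^bsub>F\<^esub> u c \<oplus>\<^bsub>F\<^esub> \<beta> \<otimes>\<^bsub>F\<^esub> w c = \<zero>\<^bsub>F\<^esub>) \<longrightarrow> \<alpha> = \<zero>\<^bsub>F\<^esub> \<and> \<beta> = \<zero>\<^bsub>F\<^esub>)"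

section \<open>The fundamental poset and order ideals\<close>

definition fund_poset :: "(nat \<times> nat) set" where
  "fund_poset = {(v, l). v < l}"

definition fund_le :: "nat \<times> nat \<Rightarrow> nat \<times> nat \<Rightarrow> bool" where
  "fund_le = (\<lambda>(v, l) (v', l'). v \<ge> v' \<and> int l - int v \<le> int l' - int v')"

definition order_ideal :: "(nat \<times> nat) set \<Rightarrow> bool" where
  "order_ideal I \<longleftrightarrow>
     I \<subseteq> fund_poset \<and> (\<forall>p\<in>I. \<forall>q\<in>fund_poset. fund_le q p \<longrightarrow> q \<in> I)"

definition gen_ideal :: "(nat \<times> nat) set \<Rightarrow> (nat \<times> nat) set" where
  "gen_ideal A = {p \<in> fund_poset. \<exists>x\<in>A. fund_le p x}"

definition max_elts :: "(nat \<times> nat) set \<Rightarrow> (nat \<times> nat) set" where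
  "max_elts I = {p \<in> I. \<forall>q\<in>I. fund_le p q \<longrightarrow> q = p}"

definition J_lam :: "nat \<Rightarrow> (nat \<Rightarrow> nat) \<Rightarrow> (nat \<times> nat) set set" where
  "J_lam k lam = {I. order_ideal I \<and> max_elts I \<subseteq> {(v, lam i) | v i. i \<in> {1..k}}}"

text \<open>All representatives of a non-zero element of \<open>R/\<pi>\<^sup>nR\<close> have the same valuation, while the zero
  coset contains \<open>0\<close>; so the supremum below is the valuation on \<open>R/\<pi>\<^sup>nR\<close>, with value \<open>\<infinity>\<close>
  at \<open>0\<close>.\<close>

definition qval :: "('a, 'b) ring_scheme \<Rightarrow> 'a \<Rightarrow> 'a set \<Rightarrow> enat" where
  "qval R \<pi> C = (SUP x\<in>C. val R \<pi> x)"

text \<open>The minimal valuation in a block is finite iff the block is non-zero, so only non-zero blocks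
  contribute a pair.\<close>

definition block_pairs ::
  "('a, 'b) ring_scheme \<Rightarrow> 'a \<Rightarrow> nat \<Rightarrow> (nat \<Rightarrow> nat) \<Rightarrow> (nat \<Rightarrow> nat) \<Rightarrow>
    (nat \<times> nat \<Rightarrow> 'a set) \<Rightarrow> (nat \<times> nat) set" where
  "block_pairs R \<pi> h \<mu> \<sigma> e =
     {(v, \<mu> i) | v i. i \<in> {1..h} \<and> (INF c\<in>{1..\<sigma> i}. qval R \<pi> (e (i, c))) = enat v}"

definition is_decomposition ::
  "('a, 'b) ring_scheme \<Rightarrow> 'a \<Rightarrow> ('a, 'm) module \<Rightarrow> nat \<Rightarrow> (nat \<Rightarrow> nat) \<Rightarrow> (nat \<Rightarrow> nat) \<Rightarrow>
    ('m \<Rightarrow> nat \<times> nat \<Rightarrow> 'a set) \<Rightarrow> bool" where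
  "is_decomposition R \<pi> M h \<mu> \<sigma> \<phi> \<longleftrightarrow>
     (\<forall>i\<in>{1..h}. \<mu> i \<ge> 1 \<and> \<sigma> i \<ge> 1) \<and> inj_on \<mu> {1..h} \<and>
     \<phi> \<in> module_iso R M (R_lam R \<pi> h \<mu> \<sigma>)"

text \<open>The ideal \<open>I(e)\<close> of an element of a finite module; the choice fixes an isomorphism of \<open>M\<close> with a
  direct sum of cyclic modules.\<close>

definition elt_ideal ::
  "('a, 'b) ring_scheme \<Rightarrow> 'a \<Rightarrow> ('a, 'm) module \<Rightarrow> 'm \<Rightarrow> (nat \<times> nat) set" where
  "elt_ideal R \<pi> M e =
     (let (h, \<mu>, \<sigma>, \<phi>) = (SOME (h, \<mu>, \<sigma>, \<phi>). is_decomposition R \<pi> M h \<mu> \<sigma> \<phi>)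
      in gen_ideal (block_pairs R \<pi> h \<mu> \<sigma> (\<phi> e)))"

definition ideal_part ::
  "('a, 'b) ring_scheme \<Rightarrow> 'a \<Rightarrow> ('a, 'm) module \<Rightarrow> (nat \<times> nat) set \<Rightarrow> 'm set" where
  "ideal_part R \<pi> M I = {e \<in> carrier M. elt_ideal R \<pi> M e \<subseteq> I}"

definition ideal_star ::
  "('a, 'b) ring_scheme \<Rightarrow> 'a \<Rightarrow> ('a, 'm) module \<Rightarrow> (nat \<times> nat) set \<Rightarrow> 'm set" where
  "ideal_star R \<pi> M I = {e \<in> carrier M. elt_ideal R \<pi> M e = I}"

section \<open>Canonical forms and stabilizer orbits\<close>

definition canonical_form ::
  "('a, 'b) ring_scheme \<Rightarrow> 'a \<Rightarrow> nat \<Rightarrow> (nat \<Rightarrow> nat) \<Rightarrow> (nat \<Rightarrow> nat) \<Rightarrow> nat set \<Rightarrow> (nat \<Rightarrow> nat) \<Rightarrow>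
    nat \<times> nat \<Rightarrow> 'a set" where
  "canonical_form R \<pi> k lam \<rho> S s =
     (\<lambda>(i, c)\<in>idx k \<rho>. cls R \<pi> (lam i) (if i \<in> S \<and> c = 1 then \<pi> [^]\<^bsub>R\<^esub> s i else \<zero>\<^bsub>R\<^esub>))"

definition stab_group ::
  "('a, 'b) ring_scheme \<Rightarrow> ('a, 'm) module \<Rightarrow> 'm \<Rightarrow> ('m \<Rightarrow> 'm) monoid" where
  "stab_group R M e =
     (module_Aut R M)\<lparr>carrier := stabilizer (module_Aut R M) (\<lambda>g. g) e\<rparr>"

text \<open>The summands of \<open>R\<^sub>\<lambda>\<close> forming \<open>R\<^sub>\<lambda>\<^sub>'\<close> and \<open>R\<^sub>\<lambda>\<^sub>'\<^sub>'\<close>; the components \<open>m'\<close> and \<open>m''\<close> of \<open>m\<close> are its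
  restrictions to the two index sets.\<close>

definition idx1 :: "nat set \<Rightarrow> (nat \<times> nat) set" where
  "idx1 S = {(i, 1) | i. i \<in> S}"

definition idx2 :: "nat \<Rightarrow> (nat \<Rightarrow> nat) \<Rightarrow> nat set \<Rightarrow> (nat \<times> nat) set" where
  "idx2 k \<rho> S = idx k \<rho> - idx1 S"

definition bar_ideal ::
  "('a, 'b) ring_scheme \<Rightarrow> 'a \<Rightarrow> (nat \<Rightarrow> nat) \<Rightarrow> nat set \<Rightarrow>
    (nat \<times> nat \<Rightarrow> 'a set) \<Rightarrow> (nat \<times> nat \<Rightarrow> 'a set) \<Rightarrow> (nat \<times> nat) set" where
  "bar_ideal R \<pi> lam S e m =
     (let M' = cyc_sum R \<pi> lam (idx1 S);
          N = cyclic_submodule R M' (restrict e (idx1 S))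
      in elt_ideal R \<pi> (quot_module M' N) (N +>\<^bsub>M'\<^esub> restrict m (idx1 S)))"

text \<open>The set \<open>\<O>\<close> with parameters \<open>m'\<close>, \<open>J\<close>, \<open>K\<close>; it is a subset of \<open>R\<^sub>\<lambda>\<close> described through the two
  components of its elements.\<close>

definition stab_orbit ::
  "('a, 'b) ring_scheme \<Rightarrow> 'a \<Rightarrow> nat \<Rightarrow> (nat \<Rightarrow> nat) \<Rightarrow> (nat \<Rightarrow> nat) \<Rightarrow> nat set \<Rightarrow>
    (nat \<times> nat \<Rightarrow> 'a set) \<Rightarrow> (nat \<times> nat) set \<Rightarrow> (nat \<times> nat) set \<Rightarrow>
    (nat \<times> nat \<Rightarrow> 'a set) set" where
  "stab_orbit R \<pi> k lam \<rho> S m' J K =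
     (let M' = cyc_sum R \<pi> lam (idx1 S); M'' = cyc_sum R \<pi> lam (idx2 k \<rho> S) in
      {l \<in> carrier (R_lam R \<pi> k lam \<rho>).
         restrict l (idx1 S) \<in> m' <+\<^bsub>M'\<^esub> ideal_part R \<pi> M' (J \<union> K) \<and>
         restrict l (idx2 k \<rho> S) \<in> ideal_star R \<pi> M'' K <+>\<^bsub>M''\<^esub> ideal_part R \<pi> M'' J})"

section \<open>Characteristic elements\<close>

definition r_exp :: "(nat \<Rightarrow> nat) \<Rightarrow> (nat \<times> nat) set \<Rightarrow> (nat \<times> nat) set \<Rightarrow> nat \<Rightarrow> enat" where
  "r_exp lam J K i = (INF v\<in>{v. (v, lam i) \<in> J \<union> K}. enat v)"

text \<open>For \<open>i \<in> S\<close> the position \<open>c = 1\<close> belongs to \<open>R\<^sub>\<lambda>\<^sub>'\<close>, so the first coordinate of the \<open>i\<close>-th block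
  of \<open>R\<^sub>\<lambda>\<^sub>'\<^sub>'\<close> is at \<open>c = 2\<close>.\<close>

definition char_elt ::
  "('a, 'b) ring_scheme \<Rightarrow> 'a \<Rightarrow> nat \<Rightarrow> (nat \<Rightarrow> nat) \<Rightarrow> (nat \<Rightarrow> nat) \<Rightarrow> nat set \<Rightarrow> (nat \<Rightarrow> enat) \<Rightarrow>
    nat \<times> nat \<Rightarrow> 'a set" where
  "char_elt R \<pi> k lam \<rho> S r =
     (\<lambda>(i, c)\<in>idx2 k \<rho> S.
        cls R \<pi> (lam i) (if c = (if i \<in> S then 2 else 1) then epow R \<pi> (r i) else \<zero>\<^bsub>R\<^esub>))"

definition f_elt ::
  "('a, 'b) ring_scheme \<Rightarrow> 'a \<Rightarrow> nat \<Rightarrow> (nat \<Rightarrow> nat) \<Rightarrow> (nat \<Rightarrow> nat) \<Rightarrow> nat set \<Rightarrow> (nat \<Rightarrow> nat) \<Rightarrow>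
    (nat \<Rightarrow> enat) \<Rightarrow> (nat \<Rightarrow> 'a) \<Rightarrow> nat \<times> nat \<Rightarrow> 'a set" where
  "f_elt R \<pi> k lam \<rho> S s r y =
     (\<lambda>(i, c)\<in>idx k \<rho>. if (i, c) \<in> idx1 S then cls R \<pi> (lam i) (\<pi> [^]\<^bsub>R\<^esub> s i \<otimes>\<^bsub>R\<^esub> y i)
                     else char_elt R \<pi> k lam \<rho> S r (i, c))"

text \<open>The truncated differences \<open>lam i - lam j\<close> occur only for \<open>i < j\<close>, where \<open>lam j < lam i\<close>.\<close>

definition m_exp ::
  "('a, 'b) ring_scheme \<Rightarrow> 'a \<Rightarrow> nat \<Rightarrow> (nat \<Rightarrow> nat) \<Rightarrow> (nat \<Rightarrow> nat) \<Rightarrow> nat set \<Rightarrow> (nat \<Rightarrow> nat) \<Rightarrow>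
    (nat \<Rightarrow> enat) \<Rightarrow> (nat \<Rightarrow> 'a) \<Rightarrow> nat \<Rightarrow> enat" where
  "m_exp R \<pi> k lam \<rho> S s r y i = Min
     {(INF j\<in>{j\<in>S. j < i}. enat (s j) + val R \<pi> (y j \<ominus>\<^bsub>R\<^esub> y i)),
      (INF j\<in>{j\<in>S. j > i}. enat (lam i - lam j) + enat (s j) + val R \<pi> (y j \<ominus>\<^bsub>R\<^esub> y i)),
      (INF j\<in>{j\<in>S. j < i \<and> \<rho> j > 1}. r j),
      (INF j\<in>{j\<in>{1..k} - S. j < i}. r j),
      (INF j\<in>{j\<in>S. j > i \<and> \<rho> j > 1}. enat (lam i - lam j) + r j),
      (INF j\<in>{j\<in>{1..k} - S. j > i}. enat (lam i - lam j) + r j)}"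

end

theory Submission
  imports Defs
begin

text \<open>For \<open>v < l\<close>, a pair \<open>(v, l)\<close> lies outside \<open>I(x)\<close> iff
  \<open>x = \<pi>\<^sup>v\<^sup>+\<^sup>1 a + b\<close> for some \<open>b\<close> annihilated by \<open>\<pi>\<^sup>l\<^sup>-\<^sup>v\<^sup>-\<^sup>1\<close>. So \<open>I\<close> is invariant under
  isomorphisms, and no matrix description of the automorphisms is needed: valuations of coordinates
  of \<open>g x\<close> are read off from \<open>I(g x) = I(x)\<close>. Write \<open>b - y\<^sub>i a = g u\<close> with \<open>u = f - y\<^sub>i e\<close>. The blocks of
  \<open>u\<close> other than the \<open>i\<close>-th contribute to the \<open>i\<close>-th block of \<open>g u\<close> with valuation at least \<open>m\<^sub>i\<close>, and the
  \<open>i\<close>-th one with valuation at least \<open>r\<^sub>i\<close>. A linear dependence in case B with coefficients \<open>\<alpha>, \<beta>\<close>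
  would make every coordinate in the \<open>i\<close>-th block of \<open>g (\<alpha> u + \<beta> \<pi>\<^bsup>r\<^sub>i - s\<^sub>i\<^esup> e)\<close> divisible by
  \<open>\<pi>\<^bsup>r\<^sub>i + 1\<^esup>\<close>, although \<open>(r\<^sub>i, \<lambda>\<^sub>i)\<close> is a maximal element of the ideal of the argument.\<close>

subsection \<open>Arithmetic of the discrete valuation ring\<close>

locale uniformized_dvr = discrete_valuation_ring R for R (structure) +
  fixes \<pi>
  assumes uniformizer: "uniformizer R \<pi>"
begin

lemma pi_closed [simp, intro]: "\<pi> \<in> carrier R"
  using uniformizer by (simp add: uniformizer_def)

lemma maximalideal_PIdl_pi: "maximalideal (PIdl \<pi>) R"
  using uniformizer by (simp add: uniformizer_def)

text \<open>If \<open>\<pi>\<close> were zero, the zero ideal would be maximal, and the nonzero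
  prime ideal supplied by \<open>unique_nonzero_prime\<close> would have to be the whole
  ring.\<close>

lemma pi_nonzero: "\<pi> \<noteq> \<zero>"
proof
  assume "\<pi> = \<zero>"
  then have max0: "maximalideal {\<zero>} R"
    using maximalideal_PIdl_pi by (simp add: cgenideal_eq_genideal genideal_zero)
  obtain P where P: "primeideal P R" "P \<noteq> {\<zero>}"
    using unique_nonzero_prime by blast
  interpret P: primeideal P R by fact
  have "P = {\<zero>} \<or> P = carrier R"
    using maximalideal.I_maximal[OF max0 P.ideal_axioms] P.a_subset P.zero_closed by simp
  then have "P = carrier R"
    using P(2) by simp
  then show False
    using P(1) primeideal.I_notcarr by blast
qed

lemma pi_pow_nonzero: "\<pi> [^] (n::nat) \<noteq> \<zero>"
  by (induction n) (auto simp: pi_nonzero integral_iff)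

lemma PIdl_pi_unique:
  assumes "primeideal P R" "P \<noteq> {\<zero>}"
  shows "P = PIdl \<pi>"
proof -
  have "primeideal (PIdl \<pi>) R"
    using maximalideal_PIdl_pi by (rule maximalideal_prime)
  moreover have "PIdl \<pi> \<noteq> {\<zero>}"
    using cgenideal_self[OF pi_closed] pi_nonzero by auto
  ultimately show ?thesis
    using unique_nonzero_prime assms by blast
qed

text \<open>An irreducible divisor of \<open>x\<close> generates a maximal, hence prime, nonzero
  ideal. By uniqueness this ideal is \<open>PIdl \<pi>\<close>, so \<open>\<pi>\<close> divides that
  irreducible divisor.\<close>

lemma pi_divides_nonunit:
  assumes "x \<in> carrier R - {\<zero>}" "x \<notin> Units R"
  shows "\<pi> divides x"
proof -
  obtain b where b: "b \<in> carrier R" "ring_irreducible b" "b divides x"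
    using exists_irreducible_divisor[OF assms] by blast
  have "primeideal (PIdl b) R"
    using irreducible_imp_maximalideal[OF b(1,2)] by (rule maximalideal_prime)
  moreover have "PIdl b \<noteq> {\<zero>}"
    using cgenideal_self[OF b(1)] ring_irreducibleE(1)[OF b(1,2)] by auto
  ultimately have "PIdl b = PIdl \<pi>"
    by (rule PIdl_pi_unique)
  then have "\<pi> divides b"
    using to_contain_is_to_divide[of \<pi> b] b(1) by simp
  then show ?thesis
    using b(3) by (meson pi_closed divides_trans)
qed

lemma pi_not_unit: "\<pi> \<notin> Units R"
  using ideal_eq_carrier_iff[OF pi_closed] maximalideal.I_notcarr[OF maximalideal_PIdl_pi] by simp

text \<open>Splitting one factor \<open>\<pi>\<close> off a nonunit gives a proper divisor, and
  proper divisibility is well-founded in a principal domain. Existence follows by induction;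
  uniqueness of the exponent comes with \<open>val_unit_pi_pow\<close>.\<close>

lemma unit_pi_pow_decomp:
  assumes "x \<in> carrier R" "x \<noteq> \<zero>"
  obtains u n where "u \<in> Units R" "x = u \<otimes> \<pi> [^] (n::nat)"
proof -
  have "x \<in> carrier (mult_of R) \<longrightarrow> (\<exists>u\<in>Units R. \<exists>n::nat. x = u \<otimes> \<pi> [^] n)" for x
  proof (induction x rule: wf_induct_rule[OF mult_of.division_wellfounded])
    case (1 x)
    show ?case
    proof
      assume "x \<in> carrier (mult_of R)"
      then have x: "x \<in> carrier R - {\<zero>}" by simp
      show "\<exists>u\<in>Units R. \<exists>n::nat. x = u \<otimes> \<pi> [^] n"
      proof (cases "x \<in> Units R")
        case True
        then have "x = x \<otimes> \<pi> [^] (0::nat)" using Units_closed by simp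
        then show ?thesis using True by blast
      next
        case False
        then obtain z where z: "z \<in> carrier R" "x = \<pi> \<otimes> z"
          using pi_divides_nonunit[OF x] unfolding factor_def by blast
        then have z0: "z \<noteq> \<zero>" using x by auto
        \<comment> \<open>If \<open>x\<close> divided \<open>z\<close> as well, cancelling
          \<open>z\<close> would make \<open>\<pi>\<close> a unit.\<close>
        have "properfactor (mult_of R) z x"
        proof -
          have "z divides x" unfolding factor_def using z m_comm by force
          moreover have "\<not> x divides z"
          proof
            assume "x divides z"
            then obtain c where c: "c \<in> carrier R" "z = x \<otimes> c" unfolding factor_def by blast
            have "z = (\<pi> \<otimes> z) \<otimes> c"
              using c(2) unfolding z(2) .
            also have "\<dots> = z \<otimes> (\<pi> \<otimes> c)"
              using z(1) c(1) by (simp add: m_ac)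
            finally have "z \<otimes> \<one> = z \<otimes> (\<pi> \<otimes> c)"
              using z(1) by simp
            then have "\<pi> \<otimes> c = \<one>"
              using m_lcancel[OF z0, of \<one> "\<pi> \<otimes> c"] z(1) c(1) by simp
            then have "\<pi> \<in> Units R"
              using c(1) divides_one[OF pi_closed] unfolding factor_def by metis
            then show False using pi_not_unit by blast
          qed
          ultimately have "properfactor R z x" by (simp add: properfactor_def)
          then show ?thesis using properfactor_imp_properfactor_mult x z(1) by blast
        qed
        then have "\<exists>u\<in>Units R. \<exists>n::nat. z = u \<otimes> \<pi> [^] n"
          using 1[of z] x z(1) z0 by simp
        then obtain u n where "u \<in> Units R" "z = u \<otimes> \<pi> [^] (n::nat)"
          by blast
        then have "x = u \<otimes> \<pi> [^] Suc n"
          using z Units_closed by (simp add: m_comm m_lcomm)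
        then show ?thesis using \<open>u \<in> Units R\<close> by blast
      qed
    qed
  qed
  then show ?thesis using assms that by auto
qed

section \<open>Powers of the maximal ideal and the valuation\<close>

abbreviation P :: "nat \<Rightarrow> 'a set" where
  "P n \<equiv> PIdl (\<pi> [^] n)"

lemma ideal_P: "ideal (P n) R"
  by (simp add: cgenideal_ideal)

lemma P_iff: "x \<in> P n \<longleftrightarrow> (\<exists>z\<in>carrier R. x = z \<otimes> \<pi> [^] n)"
  by (auto simp: cgenideal_def)

lemma unit_pi_pow_in_P_iff:
  assumes u: "u \<in> Units R"
  shows "u \<otimes> \<pi> [^] w \<in> P n \<longleftrightarrow> n \<le> w"
proof
  assume "n \<le> w"
  then have "\<pi> [^] w = \<pi> [^] (w - n) \<otimes> \<pi> [^] n"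
    by (simp add: nat_pow_mult)
  then have "u \<otimes> \<pi> [^] w = (u \<otimes> \<pi> [^] (w - n)) \<otimes> \<pi> [^] n"
    using u Units_closed by (simp add: m_assoc)
  then show "u \<otimes> \<pi> [^] w \<in> P n"
    using u Units_closed unfolding P_iff by blast
next
  assume "u \<otimes> \<pi> [^] w \<in> P n"
  then obtain z where z: "z \<in> carrier R" "u \<otimes> \<pi> [^] w = z \<otimes> \<pi> [^] n"
    unfolding P_iff by blast
  show "n \<le> w"
  proof (rule ccontr)
    assume "\<not> n \<le> w"
    \<comment> \<open>One factor \<open>\<pi>\<close> is kept apart: once \<open>\<pi> [^] w\<close>
      is cancelled, it divides the unit \<open>u\<close> and therefore
      \<open>\<one>\<close>.\<close>
    then have "\<pi> [^] n = (\<pi> [^] (n - w - 1) \<otimes> \<pi>) \<otimes> \<pi> [^] w"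
      using nat_pow_mult[OF pi_closed, of "Suc (n - w - 1)" w] by simp
    then have "u \<otimes> \<pi> [^] w = (z \<otimes> \<pi> [^] (n - w - 1) \<otimes> \<pi>) \<otimes> \<pi> [^] w"
      using z by (simp add: m_assoc)
    then have "u = (z \<otimes> \<pi> [^] (n - w - 1)) \<otimes> \<pi>"
      using m_rcancel[OF pi_pow_nonzero] u z(1) Units_closed by simp
    then have "\<one> = inv u \<otimes> ((z \<otimes> \<pi> [^] (n - w - 1)) \<otimes> \<pi>)"
      using Units_l_inv[OF u] by simp
    also have "\<dots> = \<pi> \<otimes> (inv u \<otimes> (z \<otimes> \<pi> [^] (n - w - 1)))"
      using u z(1) by (simp add: m_ac)
    finally have "\<one> = \<pi> \<otimes> (inv u \<otimes> (z \<otimes> \<pi> [^] (n - w - 1)))" .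
    then have "\<pi> divides \<one>"
      using u z(1) unfolding factor_def by blast
    then show False
      using pi_not_unit divides_one by blast
  qed
qed

lemma val_zero [simp]: "val R \<pi> \<zero> = \<infinity>"
  by (simp add: val_def)

text \<open>Justifies the definite description in \<open>val\<close>: the exponent is determined by
  the ideals \<open>P n\<close> that contain the element, whatever unit is chosen.\<close>

lemma val_unit_pi_pow:
  assumes u: "u \<in> Units R"
  shows "val R \<pi> (u \<otimes> \<pi> [^] w) = enat w"
proof -
  have "u \<otimes> \<pi> [^] w \<noteq> \<zero>"
    using unit_pi_pow_in_P_iff[OF u, of w "Suc w"]
      additive_subgroup.zero_closed[OF ideal.axioms(1)[OF ideal_P], of "Suc w"] by auto
  moreover have "(THE n. \<exists>v \<in> Units R. u \<otimes> \<pi> [^] w = v \<otimes> \<pi> [^] n) = w"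
  proof (rule the_equality)
    fix n :: nat assume "\<exists>v \<in> Units R. u \<otimes> \<pi> [^] w = v \<otimes> \<pi> [^] n"
    then obtain v where v: "v \<in> Units R" "u \<otimes> \<pi> [^] w = v \<otimes> \<pi> [^] n" by blast
    then show "n = w"
      using unit_pi_pow_in_P_iff[OF u, of w n] unit_pi_pow_in_P_iff[OF v(1), of n w]
        unit_pi_pow_in_P_iff[OF u, of w w] unit_pi_pow_in_P_iff[OF v(1), of n n] by simp
  qed (use u in blast)
  ultimately show ?thesis by (simp add: val_def)
qed

text \<open>Translates congruences modulo powers of \<open>\<pi>\<close> into inequalities between
  extended naturals, the form in which all later estimates are made.\<close>

lemma in_P_iff_val:
  assumes "x \<in> carrier R"
  shows "x \<in> P n \<longleftrightarrow> enat n \<le> val R \<pi> x"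
proof (cases "x = \<zero>")
  case True
  then show ?thesis
    by (simp add: additive_subgroup.zero_closed[OF ideal.axioms(1)[OF ideal_P]])
next
  case False
  then obtain u w where "u \<in> Units R" "x = u \<otimes> \<pi> [^] (w::nat)"
    using assms unit_pi_pow_decomp by blast
  then show ?thesis
    using val_unit_pi_pow unit_pi_pow_in_P_iff by simp
qed

lemma val_add:
  assumes "x \<in> carrier R" "y \<in> carrier R" "t \<le> val R \<pi> x" "t \<le> val R \<pi> y"
  shows "t \<le> val R \<pi> (x \<oplus> y)"
proof -
  have fin: "enat n \<le> val R \<pi> (x \<oplus> y)" if "enat n \<le> t" for n
  proof -
    have "x \<in> P n" "y \<in> P n"
      using assms that in_P_iff_val order_trans by blast+
    then have "x \<oplus> y \<in> P n"
      using additive_subgroup.a_closed[OF ideal.axioms(1)[OF ideal_P]] by blast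
    then show ?thesis using assms in_P_iff_val by blast
  qed
  show ?thesis
  proof (cases t)
    case (enat n)
    then show ?thesis using fin by simp
  next
    \<comment> \<open>A finite value \<open>n\<close> of the sum would contradict the bound already
      available for \<open>Suc n\<close>.\<close>
    case infinity
    show ?thesis
    proof (cases "val R \<pi> (x \<oplus> y)")
      case (enat n)
      then show ?thesis
        using fin[of "Suc n"] infinity by simp
    qed simp
  qed
qed

lemma val_mult:
  assumes "x \<in> carrier R" "y \<in> carrier R"
  shows "val R \<pi> (x \<otimes> y) = val R \<pi> x + val R \<pi> y"
proof (cases "x = \<zero> \<or> y = \<zero>")
  case True
  then show ?thesis using assms by auto
next
  case False
  obtain u v :: 'a and w z :: nat where uv: "u \<in> Units R" "x = u \<otimes> \<pi> [^] w" "v \<in> Units R" "y = v \<otimes> \<pi> [^] z"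
    using False assms unit_pi_pow_decomp by metis
  then have "x \<otimes> y = (u \<otimes> v) \<otimes> \<pi> [^] (w + z)"
    using Units_closed by (simp add: nat_pow_mult[symmetric] m_ac)
  then show ?thesis
    using uv val_unit_pi_pow Units_m_closed by simp
qed

lemma val_unit: "u \<in> Units R \<Longrightarrow> val R \<pi> u = 0"
  using val_unit_pi_pow[of u 0] Units_closed by (simp add: zero_enat_def)

lemma val_pi_pow: "val R \<pi> (\<pi> [^] (n::nat)) = enat n"
  using val_unit_pi_pow[of \<one> n] by simp

lemma epow_closed [simp, intro]: "epow R \<pi> t \<in> carrier R"
  by (cases t) (auto simp: epow_def)

lemma val_epow: "val R \<pi> (epow R \<pi> t) = t"
  by (cases t) (auto simp: epow_def val_pi_pow)

lemma epow_divides: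
  assumes "x \<in> carrier R" "t \<le> val R \<pi> x"
  obtains z where "z \<in> carrier R" "x = epow R \<pi> t \<otimes> z"
proof (cases t)
  case (enat n)
  then show ?thesis
    using assms in_P_iff_val[of x n] P_iff[of x n] that by (auto simp: epow_def m_comm)
next
  case infinity
  then have "val R \<pi> x = \<infinity>" using assms by simp
  then have "x = \<zero>" by (auto simp: val_def split: if_splits)
  then show ?thesis using that[of \<zero>] by simp
qed

end

subsection \<open>Quotients and direct sums\<close>

context uniformized_dvr begin

lemma carrier_cyc: "carrier (cyc R \<pi> n) = cls R \<pi> n ` carrier R"
  by (auto simp: cyc_def Let_def FactRing_def A_RCOSETS_def' cls_def)

lemma cls_closed [simp, intro]: "x \<in> carrier R \<Longrightarrow> cls R \<pi> n x \<in> carrier (cyc R \<pi> n)"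
  by (simp add: carrier_cyc)

lemma cls_eq_iff:
  assumes "x \<in> carrier R" "y \<in> carrier R"
  shows "cls R \<pi> n x = cls R \<pi> n y \<longleftrightarrow> x \<ominus> y \<in> P n"
  unfolding cls_def using quotient_eq_iff_same_a_r_cos[OF ideal_P assms] by blast

lemma abelian_subgroup_P: "abelian_subgroup (P n) R"
  using abelian_subgroupI3[OF ideal.axioms(1)[OF ideal_P]] abelian_group_axioms by blast

lemma cls_add:
  assumes "x \<in> carrier R" "y \<in> carrier R"
  shows "cls R \<pi> n x \<oplus>\<^bsub>cyc R \<pi> n\<^esub> cls R \<pi> n y = cls R \<pi> n (x \<oplus> y)"
  using abelian_subgroup.a_rcos_sum[OF abelian_subgroup_P assms]
  by (simp add: cyc_def Let_def FactRing_def cls_def)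

lemma cls_smult:
  assumes "x \<in> carrier R" "y \<in> carrier R"
  shows "x \<odot>\<^bsub>cyc R \<pi> n\<^esub> cls R \<pi> n y = cls R \<pi> n (x \<otimes> y)"
  using ideal.rcoset_mult_add[OF ideal_P assms]
  by (simp add: cyc_def Let_def FactRing_def cls_def)

lemma zero_cyc: "\<zero>\<^bsub>cyc R \<pi> n\<^esub> = cls R \<pi> n \<zero>"
proof -
  interpret abelian_subgroup "P n" R by (rule abelian_subgroup_P)
  show ?thesis by (simp add: cyc_def Let_def FactRing_def cls_def a_rcos_const)
qed

lemma cls_eq_zero_iff:
  assumes "x \<in> carrier R"
  shows "cls R \<pi> n x = \<zero>\<^bsub>cyc R \<pi> n\<^esub> \<longleftrightarrow> enat n \<le> val R \<pi> x"
  using assms by (simp add: zero_cyc cls_eq_iff in_P_iff_val minus_eq)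

text \<open>Representatives differ by elements of \<open>P n\<close>, which cannot change a
  valuation below \<open>n\<close>. From \<open>n\<close> on the coset contains zero, and the
  supremum in \<open>qval\<close> jumps to infinity.\<close>

lemma qval_cls:
  assumes x: "x \<in> carrier R"
  shows "qval R \<pi> (cls R \<pi> n x) = (if val R \<pi> x < enat n then val R \<pi> x else \<infinity>)"
proof -
  interpret abelian_subgroup "P n" R by (rule abelian_subgroup_P)
  have mem: "z \<in> cls R \<pi> n x \<Longrightarrow> z \<in> carrier R \<and> enat n \<le> val R \<pi> (z \<ominus> x)" for z
  proof -
    assume "z \<in> cls R \<pi> n x"
    then have z: "z \<in> P n +> x" by (simp only: cls_def)
    then have c: "z \<in> carrier R" by (rule a_elemrcos_carrier[OF x])
    then have "z \<ominus> x \<in> P n"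
      using a_rcos_module_minus[OF ring_axioms x] z by blast
    then show ?thesis
      using c x in_P_iff_val[OF minus_closed] by blast
  qed
  show ?thesis
  proof (cases "val R \<pi> x < enat n")
    case True
    have nonempty: "cls R \<pi> n x \<noteq> {}"
      unfolding cls_def using a_rcos_self[OF x] by blast
    have "val R \<pi> z = val R \<pi> x" if "z \<in> cls R \<pi> n x" for z
    proof -
      have z: "z \<in> carrier R" "enat n \<le> val R \<pi> (z \<ominus> x)" using mem that by auto
      have "cls R \<pi> n z = cls R \<pi> n x"
        using x z by (simp add: cls_eq_iff in_P_iff_val)
      then have z': "enat n \<le> val R \<pi> (x \<ominus> z)"
        using x z(1) by (simp add: cls_eq_iff[symmetric] in_P_iff_val[symmetric])
      \<comment> \<open>Each of \<open>x\<close> and \<open>z\<close> is the other plus an element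
        of \<open>P n\<close>, so bounds \<open>t \<le> enat n\<close> pass in both directions. The
        choices \<open>w\<close> and \<open>Suc w\<close> for \<open>t\<close> then pin down the
        valuation of \<open>z\<close>.\<close>
      have "z = x \<oplus> (z \<ominus> x)" "x = z \<oplus> (x \<ominus> z)"
        using x z(1) a_lcomm[of x z "\<ominus> x"] a_lcomm[of z x "\<ominus> z"] by (simp_all add: minus_eq r_neg)
      then have le: "t \<le> val R \<pi> x \<Longrightarrow> t \<le> enat n \<Longrightarrow> t \<le> val R \<pi> z"
        "t \<le> val R \<pi> z \<Longrightarrow> t \<le> enat n \<Longrightarrow> t \<le> val R \<pi> x" for t
        using val_add[of x "z \<ominus> x" t] val_add[of z "x \<ominus> z" t] x z z'
        by (metis minus_closed order_trans)+
      obtain w where w: "val R \<pi> x = enat w" "w < n"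
        using True by (cases "val R \<pi> x") auto
      have "enat w \<le> val R \<pi> z" "\<not> enat (Suc w) \<le> val R \<pi> z"
        using le(1)[of "enat w"] le(2)[of "enat (Suc w)"] w by auto
      then show ?thesis
        using w by (cases "val R \<pi> z") auto
    qed
    then have "qval R \<pi> (cls R \<pi> n x) = val R \<pi> x"
      unfolding qval_def using nonempty by (intro SUP_eq_const)
    then show ?thesis using True by simp
  next
    case False
    then have "cls R \<pi> n x = cls R \<pi> n \<zero>"
      using x cls_eq_zero_iff by (simp add: zero_cyc not_less)
    then have "\<zero> \<in> cls R \<pi> n x"
      using a_rcos_self[of \<zero>] by (simp add: cls_def)
    then have "val R \<pi> \<zero> \<le> qval R \<pi> (cls R \<pi> n x)"
      unfolding qval_def by (rule SUP_upper)
    then show ?thesis using False by simp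
  qed
qed

lemma le_qval_cls_iff:
  assumes "x \<in> carrier R"
  shows "t \<le> qval R \<pi> (cls R \<pi> n x) \<longleftrightarrow> min t (enat n) \<le> val R \<pi> x"
  using assms by (auto simp: qval_cls min_def)

lemma qval_add:
  assumes "C \<in> carrier (cyc R \<pi> n)" "D \<in> carrier (cyc R \<pi> n)"
    and "t \<le> qval R \<pi> C" "t \<le> qval R \<pi> D"
  shows "t \<le> qval R \<pi> (C \<oplus>\<^bsub>cyc R \<pi> n\<^esub> D)"
  using assms val_add by (auto simp: carrier_cyc cls_add le_qval_cls_iff)

text \<open>Only an inequality, because the product may vanish in the quotient and then has infinite
  \<open>qval\<close>.\<close>

lemma qval_smult:
  assumes "a \<in> carrier R" "C \<in> carrier (cyc R \<pi> n)"
  shows "qval R \<pi> C + val R \<pi> a \<le> qval R \<pi> (a \<odot>\<^bsub>cyc R \<pi> n\<^esub> C)"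
proof -
  obtain x where x: "x \<in> carrier R" "C = cls R \<pi> n x"
    using assms(2) by (auto simp: carrier_cyc)
  show ?thesis
  proof (cases "val R \<pi> x < enat n")
    case True
    then show ?thesis
      using x assms(1) by (auto simp: cls_smult qval_cls val_mult add.commute)
  next
    case False
    then have "enat n \<le> val R \<pi> a + val R \<pi> x"
      by (metis add.commute add_increasing2 i0_lb not_less)
    then show ?thesis
      using x assms(1) by (simp add: cls_smult qval_cls val_mult leD)
  qed
qed

lemma abelian_group_cyc: "abelian_group (cyc R \<pi> n)"
proof (rule abelian_groupI)
  fix x assume "x \<in> carrier (cyc R \<pi> n)"
  then obtain a where a: "a \<in> carrier R" "x = cls R \<pi> n a" by (auto simp: carrier_cyc)
  then have "cls R \<pi> n (\<ominus> a) \<oplus>\<^bsub>cyc R \<pi> n\<^esub> x = \<zero>\<^bsub>cyc R \<pi> n\<^esub>"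
    by (simp add: cls_add zero_cyc l_neg)
  then show "\<exists>y\<in>carrier (cyc R \<pi> n). y \<oplus>\<^bsub>cyc R \<pi> n\<^esub> x = \<zero>\<^bsub>cyc R \<pi> n\<^esub>"
    using a by blast
qed (auto simp: carrier_cyc cls_add zero_cyc a_ac)

lemma smult_cyc_closed:
  "a \<in> carrier R \<Longrightarrow> C \<in> carrier (cyc R \<pi> n) \<Longrightarrow> a \<odot>\<^bsub>cyc R \<pi> n\<^esub> C \<in> carrier (cyc R \<pi> n)"
  by (auto simp: carrier_cyc cls_smult)

end

lemma abelian_group_direct_sum:
  assumes "\<And>i. i \<in> A \<Longrightarrow> abelian_group (M i)"
  shows "abelian_group (direct_sum A M)"
proof -
  have monoid: "abelian_monoid (M i)" if "i \<in> A" for i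
    using assms[OF that] by (rule abelian_group.axioms(1))
  show ?thesis
  proof (rule abelian_groupI)
    fix x assume "x \<in> carrier (direct_sum A M)"
    then have x: "x i \<in> carrier (M i)" if "i \<in> A" for i
      using that by (auto simp: direct_sum_def)
    have "(\<lambda>i\<in>A. \<ominus>\<^bsub>M i\<^esub> x i) \<oplus>\<^bsub>direct_sum A M\<^esub> x = \<zero>\<^bsub>direct_sum A M\<^esub>"
      using x assms by (auto simp: direct_sum_def abelian_group.l_neg)
    moreover have "(\<lambda>i\<in>A. \<ominus>\<^bsub>M i\<^esub> x i) \<in> carrier (direct_sum A M)"
      using x assms by (auto simp: direct_sum_def abelian_group.a_inv_closed)
    ultimately show "\<exists>y\<in>carrier (direct_sum A M). y \<oplus>\<^bsub>direct_sum A M\<^esub> x = \<zero>\<^bsub>direct_sum A M\<^esub>"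
      by blast
  next
    fix x assume x: "x \<in> carrier (direct_sum A M)"
    show "\<zero>\<^bsub>direct_sum A M\<^esub> \<oplus>\<^bsub>direct_sum A M\<^esub> x = x"
    proof (rule extensionalityI[of _ A])
      fix i assume "i \<in> A"
      then show "(\<zero>\<^bsub>direct_sum A M\<^esub> \<oplus>\<^bsub>direct_sum A M\<^esub> x) i = x i"
        using x abelian_monoid.l_zero[OF monoid, of i "x i"] by (auto simp: direct_sum_def)
    qed (use x in \<open>simp_all add: direct_sum_def PiE_def\<close>)
  next
    show "\<zero>\<^bsub>direct_sum A M\<^esub> \<in> carrier (direct_sum A M)"
      using abelian_monoid.zero_closed[OF monoid] by (simp add: direct_sum_def)
  next
    fix x y assume "x \<in> carrier (direct_sum A M)" "y \<in> carrier (direct_sum A M)"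
    then have xy: "x i \<in> carrier (M i)" "y i \<in> carrier (M i)" if "i \<in> A" for i
      using that by (auto simp: direct_sum_def)
    show "x \<oplus>\<^bsub>direct_sum A M\<^esub> y \<in> carrier (direct_sum A M)"
      using xy abelian_monoid.a_closed[OF monoid] by (simp add: direct_sum_def)
    show "x \<oplus>\<^bsub>direct_sum A M\<^esub> y = y \<oplus>\<^bsub>direct_sum A M\<^esub> x"
      using xy abelian_monoid.a_comm[OF monoid] by (auto simp: direct_sum_def intro!: restrict_ext)
    fix z assume "z \<in> carrier (direct_sum A M)"
    then have z: "z i \<in> carrier (M i)" if "i \<in> A" for i
      using that by (auto simp: direct_sum_def)
    show "x \<oplus>\<^bsub>direct_sum A M\<^esub> y \<oplus>\<^bsub>direct_sum A M\<^esub> z = x \<oplus>\<^bsub>direct_sum A M\<^esub> (y \<oplus>\<^bsub>direct_sum A M\<^esub> z)"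
      using xy z abelian_monoid.a_assoc[OF monoid] by (auto simp: direct_sum_def intro!: restrict_ext)
  qed
qed

subsection \<open>Isomorphism invariance of the ideal of an element\<close>

context uniformized_dvr begin

text \<open>Phrased by addition and scalar multiplication alone, so that it makes sense before any
  decomposition into cyclic summands is chosen.\<close>

definition splits_at :: "('a, 'm) module \<Rightarrow> nat \<Rightarrow> nat \<Rightarrow> 'm \<Rightarrow> bool" where
  "splits_at M v l x \<longleftrightarrow> (\<exists>a\<in>carrier M. \<exists>b\<in>carrier M.
     x = (\<pi> [^] Suc v \<odot>\<^bsub>M\<^esub> a) \<oplus>\<^bsub>M\<^esub> b \<and> \<pi> [^] (l - Suc v) \<odot>\<^bsub>M\<^esub> b = \<zero>\<^bsub>M\<^esub>)"

text \<open>With truncated subtraction, \<open>w + (l - n) \<le> v\<close> expresses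
  \<open>fund_le (v, l) (w, n)\<close>. Under this relation both summands of a splitting have
  valuation above \<open>w\<close>, while \<open>C\<close> has valuation \<open>w\<close>; without
  it one summand can be taken to be zero.\<close>

lemma splits_at_cyc_iff:
  assumes C: "C \<in> carrier (cyc R \<pi> n)" and vl: "v < l"
  shows "splits_at (cyc R \<pi> n) v l C \<longleftrightarrow> \<not> (\<exists>w. qval R \<pi> C = enat w \<and> w + (l - n) \<le> v)"
    (is "_ \<longleftrightarrow> \<not> ?Q")
proof
  obtain x where x: "x \<in> carrier R" "C = cls R \<pi> n x"
    using C by (auto simp: carrier_cyc)
  show "\<not> ?Q" if sp: "splits_at (cyc R \<pi> n) v l C"
  proof
    assume ?Q
    then obtain w where w: "qval R \<pi> C = enat w" "w + (l - n) \<le> v" by blast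
    then have "w < n" using x by (simp add: qval_cls split: if_splits)
    obtain a b where ab: "a \<in> carrier R" "b \<in> carrier R"
      "C = (\<pi> [^] Suc v \<odot>\<^bsub>cyc R \<pi> n\<^esub> cls R \<pi> n a) \<oplus>\<^bsub>cyc R \<pi> n\<^esub> cls R \<pi> n b"
      "\<pi> [^] (l - Suc v) \<odot>\<^bsub>cyc R \<pi> n\<^esub> cls R \<pi> n b = \<zero>\<^bsub>cyc R \<pi> n\<^esub>"
      using sp by (auto simp: splits_at_def carrier_cyc)
    have "enat n \<le> enat (l - Suc v) + val R \<pi> b"
      using ab by (simp add: cls_smult cls_eq_zero_iff val_mult val_pi_pow del: nat_pow_Suc)
    \<comment> \<open>The annihilation forces valuation at least \<open>n - (l - Suc v)\<close> on
      \<open>b\<close>, and \<open>w + (l - n) \<le> v\<close> makes this exceed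
      \<open>w\<close>.\<close>
    then have "enat (Suc w) \<le> val R \<pi> b"
      using w(2) vl \<open>w < n\<close> by (cases "val R \<pi> b") auto
    then have "enat (Suc w) \<le> qval R \<pi> (cls R \<pi> n b)"
      unfolding le_qval_cls_iff[OF ab(2)] by (rule min.coboundedI1)
    moreover have "enat (Suc w) \<le> enat (Suc v) + val R \<pi> a"
      using w(2) by (cases "val R \<pi> a") auto
    then have "enat (Suc w) \<le> qval R \<pi> (\<pi> [^] Suc v \<odot>\<^bsub>cyc R \<pi> n\<^esub> cls R \<pi> n a)"
      using cls_smult[of "\<pi> [^] Suc v" a n] le_qval_cls_iff[of "\<pi> [^] Suc v \<otimes> a" "enat (Suc w)" n]
        val_mult[of "\<pi> [^] Suc v" a] val_pi_pow[of "Suc v"] ab(1)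
        min.coboundedI1[of "enat (Suc w)" "enat (Suc v) + val R \<pi> a" "enat n"]
      by (simp only: nat_pow_closed pi_closed m_closed)
    ultimately have "enat (Suc w) \<le> qval R \<pi> C"
      unfolding ab(3) using ab(1,2) by (intro qval_add) (auto intro: smult_cyc_closed)
    then show False using w(1) by simp
  qed
  show "splits_at (cyc R \<pi> n) v l C" if nq: "\<not> ?Q"
  \<comment> \<open>Either \<open>C\<close> is itself a multiple of \<open>\<pi> [^] Suc v\<close>
    (this includes the zero coset) and \<open>b\<close> is zero, or \<open>C\<close> is itself
    annihilated and \<open>a\<close> is zero.\<close>
  proof (cases "enat (Suc v) \<le> val R \<pi> x \<or> enat n \<le> val R \<pi> x")
    case True
    then obtain z where z: "z \<in> carrier R" "C = cls R \<pi> n (\<pi> [^] Suc v \<otimes> z)"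
    proof
      assume "enat (Suc v) \<le> val R \<pi> x"
      then show ?thesis
        using that x epow_divides[OF x(1), of "enat (Suc v)"] by (auto simp: epow_def)
    next
      assume "enat n \<le> val R \<pi> x"
      then show ?thesis
        using that[of \<zero>] x cls_eq_zero_iff by (simp add: zero_cyc)
    qed
    then have "C = (\<pi> [^] Suc v \<odot>\<^bsub>cyc R \<pi> n\<^esub> cls R \<pi> n z) \<oplus>\<^bsub>cyc R \<pi> n\<^esub> cls R \<pi> n \<zero>"
      by (simp add: cls_smult cls_add del: nat_pow_Suc)
    moreover have "\<pi> [^] (l - Suc v) \<odot>\<^bsub>cyc R \<pi> n\<^esub> cls R \<pi> n \<zero> = \<zero>\<^bsub>cyc R \<pi> n\<^esub>"
      by (simp add: cls_smult zero_cyc)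
    ultimately show ?thesis
      unfolding splits_at_def using z(1) by blast
  next
    case False
    then obtain w where w: "val R \<pi> x = enat w" "w \<le> v" "w < n"
      by (cases "val R \<pi> x") auto
    then have "qval R \<pi> C = enat w"
      using x by (simp add: qval_cls)
    then have "v < w + (l - n)" using nq by auto
    then have "n \<le> (l - Suc v) + w" using w vl by simp
    then have "\<pi> [^] (l - Suc v) \<odot>\<^bsub>cyc R \<pi> n\<^esub> C = \<zero>\<^bsub>cyc R \<pi> n\<^esub>"
      using x w by (simp add: cls_smult cls_eq_zero_iff val_mult val_pi_pow)
    moreover have "C = (\<pi> [^] Suc v \<odot>\<^bsub>cyc R \<pi> n\<^esub> cls R \<pi> n \<zero>) \<oplus>\<^bsub>cyc R \<pi> n\<^esub> C"
      using x by (simp add: cls_smult cls_add del: nat_pow_Suc)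
    ultimately show ?thesis
      unfolding splits_at_def using C by blast
  qed
qed

lemma splits_at_direct_sum_iff:
  assumes x: "x \<in> carrier (direct_sum A M)"
  shows "splits_at (direct_sum A M) v l x \<longleftrightarrow> (\<forall>p\<in>A. splits_at (M p) v l (x p))"
proof
  assume "splits_at (direct_sum A M) v l x"
  then obtain a b where ab: "a \<in> (\<Pi>\<^sub>E p\<in>A. carrier (M p))" "b \<in> (\<Pi>\<^sub>E p\<in>A. carrier (M p))"
    "x = (\<lambda>p\<in>A. (\<pi> [^] Suc v \<odot>\<^bsub>M p\<^esub> a p) \<oplus>\<^bsub>M p\<^esub> b p)"
    "(\<lambda>p\<in>A. \<pi> [^] (l - Suc v) \<odot>\<^bsub>M p\<^esub> b p) = (\<lambda>p\<in>A. \<zero>\<^bsub>M p\<^esub>)"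
    unfolding splits_at_def by (auto simp: direct_sum_def cong: restrict_cong simp del: nat_pow_Suc)
  show "\<forall>p\<in>A. splits_at (M p) v l (x p)"
  proof
    fix p assume p: "p \<in> A"
    then have "x p = (\<pi> [^] Suc v \<odot>\<^bsub>M p\<^esub> a p) \<oplus>\<^bsub>M p\<^esub> b p"
      "\<pi> [^] (l - Suc v) \<odot>\<^bsub>M p\<^esub> b p = \<zero>\<^bsub>M p\<^esub>"
      using ab(3) fun_cong[OF ab(4), of p] by simp_all
    then show "splits_at (M p) v l (x p)"
      unfolding splits_at_def using p ab(1,2) PiE_mem by blast
  qed
next
  assume "\<forall>p\<in>A. splits_at (M p) v l (x p)"
  then obtain a b where ab: "\<And>p. p \<in> A \<Longrightarrow> a p \<in> carrier (M p) \<and> b p \<in> carrier (M p) \<and>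
     x p = (\<pi> [^] Suc v \<odot>\<^bsub>M p\<^esub> a p) \<oplus>\<^bsub>M p\<^esub> b p \<and> \<pi> [^] (l - Suc v) \<odot>\<^bsub>M p\<^esub> b p = \<zero>\<^bsub>M p\<^esub>"
    unfolding splits_at_def by metis
  show "splits_at (direct_sum A M) v l x"
    unfolding splits_at_def
  proof (intro bexI conjI)
    show "x = (\<pi> [^] Suc v \<odot>\<^bsub>direct_sum A M\<^esub> restrict a A) \<oplus>\<^bsub>direct_sum A M\<^esub> restrict b A"
    proof (rule extensionalityI[of x A])
      show "x \<in> extensional A"
        using x by (simp add: direct_sum_def PiE_def)
      fix p assume "p \<in> A"
      then show "x p = ((\<pi> [^] Suc v \<odot>\<^bsub>direct_sum A M\<^esub> restrict a A) \<oplus>\<^bsub>direct_sum A M\<^esub> restrict b A) p"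
        using ab[THEN conjunct2, THEN conjunct2, THEN conjunct1, of p]
        by (simp only: direct_sum_def monoid.simps ring.simps module.simps restrict_apply' if_True simp_thms)
    qed (simp add: direct_sum_def)
    show "restrict a A \<in> carrier (direct_sum A M)" "restrict b A \<in> carrier (direct_sum A M)"
      unfolding direct_sum_def by (auto dest: ab)
    show "\<pi> [^] (l - Suc v) \<odot>\<^bsub>direct_sum A M\<^esub> restrict b A = \<zero>\<^bsub>direct_sum A M\<^esub>"
      unfolding direct_sum_def by (auto intro!: restrict_ext dest: ab)
  qed
qed

lemma splits_at_module_iso_iff:
  assumes MN: "abelian_group M" "abelian_group N"
    and smult: "\<And>a x. a \<in> carrier R \<Longrightarrow> x \<in> carrier M \<Longrightarrow> a \<odot>\<^bsub>M\<^esub> x \<in> carrier M"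
    and \<phi>: "\<phi> \<in> module_iso R M N" and x: "x \<in> carrier M"
  shows "splits_at N v l (\<phi> x) \<longleftrightarrow> splits_at M v l x"
proof -
  interpret M: abelian_group M by fact
  interpret N: abelian_group N by fact
  have hom: "\<phi> \<in> hom (add_monoid M) (add_monoid N)" and bij: "bij_betw \<phi> (carrier M) (carrier N)"
    and sm: "\<And>a x. a \<in> carrier R \<Longrightarrow> x \<in> carrier M \<Longrightarrow> \<phi> (a \<odot>\<^bsub>M\<^esub> x) = a \<odot>\<^bsub>N\<^esub> \<phi> x"
    using \<phi> by (auto simp: module_iso_def iso_def)
  have add: "\<phi> (a \<oplus>\<^bsub>M\<^esub> b) = \<phi> a \<oplus>\<^bsub>N\<^esub> \<phi> b" if "a \<in> carrier M" "b \<in> carrier M" for a b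
    using hom that by (auto simp: hom_def)
  have zero: "\<phi> \<zero>\<^bsub>M\<^esub> = \<zero>\<^bsub>N\<^esub>"
    using hom_one[OF hom M.a_group N.a_group] by simp
  have inj: "\<phi> a = \<phi> b \<longleftrightarrow> a = b" if "a \<in> carrier M" "b \<in> carrier M" for a b
    using bij that by (auto simp: bij_betw_def inj_on_def)
  have img: "carrier N = \<phi> ` carrier M"
    using bij by (simp add: bij_betw_def)
  have "\<phi> x = (\<pi> [^] Suc v \<odot>\<^bsub>N\<^esub> \<phi> a) \<oplus>\<^bsub>N\<^esub> \<phi> b \<longleftrightarrow> x = (\<pi> [^] Suc v \<odot>\<^bsub>M\<^esub> a) \<oplus>\<^bsub>M\<^esub> b"
    and "\<pi> [^] (l - Suc v) \<odot>\<^bsub>N\<^esub> \<phi> b = \<zero>\<^bsub>N\<^esub> \<longleftrightarrow> \<pi> [^] (l - Suc v) \<odot>\<^bsub>M\<^esub> b = \<zero>\<^bsub>M\<^esub>"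
    if "a \<in> carrier M" "b \<in> carrier M" for a b
    using that x smult by (simp_all add: add[symmetric] sm[symmetric] inj zero[symmetric] del: nat_pow_Suc)
  then show ?thesis
    unfolding splits_at_def img by (auto simp del: nat_pow_Suc)
qed

lemma abelian_group_cyc_sum: "abelian_group (cyc_sum R \<pi> lam A)"
  unfolding cyc_sum_def by (rule abelian_group_direct_sum) (auto intro: abelian_group_cyc)

lemma cyc_sum_sel:
  "carrier (cyc_sum R \<pi> lam A) = (\<Pi>\<^sub>E p\<in>A. carrier (cyc R \<pi> (lam (fst p))))"
  "x \<oplus>\<^bsub>cyc_sum R \<pi> lam A\<^esub> x' = (\<lambda>p\<in>A. x p \<oplus>\<^bsub>cyc R \<pi> (lam (fst p))\<^esub> x' p)"
  "a \<odot>\<^bsub>cyc_sum R \<pi> lam A\<^esub> x = (\<lambda>p\<in>A. a \<odot>\<^bsub>cyc R \<pi> (lam (fst p))\<^esub> x p)"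
  "\<zero>\<^bsub>cyc_sum R \<pi> lam A\<^esub> = (\<lambda>p\<in>A. \<zero>\<^bsub>cyc R \<pi> (lam (fst p))\<^esub>)"
  by (auto simp: cyc_sum_def direct_sum_def case_prod_unfold)

lemma smult_cyc_sum_closed:
  "a \<in> carrier R \<Longrightarrow> x \<in> carrier (cyc_sum R \<pi> lam A) \<Longrightarrow>
    a \<odot>\<^bsub>cyc_sum R \<pi> lam A\<^esub> x \<in> carrier (cyc_sum R \<pi> lam A)"
  by (auto simp: cyc_sum_sel PiE_mem intro!: smult_cyc_closed)

text \<open>The minimum over a block is attained, so the generators may be read off from single
  coordinates instead of block minima.\<close>

lemma mem_gen_block_pairs_iff:
  "(v, l) \<in> gen_ideal (block_pairs R \<pi> h \<mu> \<sigma> x) \<longleftrightarrow>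
     v < l \<and> (\<exists>(j, c)\<in>idx h \<sigma>. \<exists>w. qval R \<pi> (x (j, c)) = enat w \<and> w + (l - \<mu> j) \<le> v)"
    (is "_ \<longleftrightarrow> _ \<and> ?R")
proof -
  have le: "fund_le (v, l) (w, m) \<longleftrightarrow> w + (l - m) \<le> v" if "v < l" for w m
    using that by (auto simp: fund_le_def)
  have "(\<exists>p\<in>block_pairs R \<pi> h \<mu> \<sigma> x. fund_le (v, l) p) \<longleftrightarrow> ?R" if vl: "v < l"
  proof
    assume "\<exists>p\<in>block_pairs R \<pi> h \<mu> \<sigma> x. fund_le (v, l) p"
    then obtain w j where j: "j \<in> {1..h}" "(INF c\<in>{1..\<sigma> j}. qval R \<pi> (x (j, c))) = enat w"
      "w + (l - \<mu> j) \<le> v"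
      using le[OF vl] by (auto simp: block_pairs_def)
    \<comment> \<open>Being finite, the infimum is not over an empty set, and in the well-order
      \<open>enat\<close> it is therefore attained.\<close>
    have "(INF c\<in>{1..\<sigma> j}. qval R \<pi> (x (j, c))) \<in> (\<lambda>c. qval R \<pi> (x (j, c))) ` {1..\<sigma> j}"
      using j(2) by (intro wellorder_InfI) (auto simp: Inf_enat_def split: if_splits)
    then show ?R
      using j by (force simp: idx_def)
  next
    assume ?R
    then obtain j c w where j: "j \<in> {1..h}" "c \<in> {1..\<sigma> j}" "qval R \<pi> (x (j, c)) = enat w"
      "w + (l - \<mu> j) \<le> v"
      by (auto simp: idx_def)
    then have "(INF c\<in>{1..\<sigma> j}. qval R \<pi> (x (j, c))) \<le> enat w"
      by (metis INF_lower)
    then obtain w' where w': "(INF c\<in>{1..\<sigma> j}. qval R \<pi> (x (j, c))) = enat w'" "w' \<le> w"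
      by (cases "INF c\<in>{1..\<sigma> j}. qval R \<pi> (x (j, c))") auto
    then have "(w', \<mu> j) \<in> block_pairs R \<pi> h \<mu> \<sigma> x"
      using j(1) by (auto simp: block_pairs_def)
    moreover have "fund_le (v, l) (w', \<mu> j)"
      using le[OF vl] w'(2) j(4) by simp
    ultimately show "\<exists>p\<in>block_pairs R \<pi> h \<mu> \<sigma> x. fund_le (v, l) p" by blast
  qed
  then show ?thesis
    by (auto simp: gen_ideal_def fund_poset_def)
qed

text \<open>Here the coordinates drop out: a pair lies outside the ideal exactly when every
  coordinate splits, and such splittings assemble to one of \<open>x\<close>.\<close>

lemma mem_gen_block_pairs_iff_splits:
  assumes x: "x \<in> carrier (R_lam R \<pi> h \<mu> \<sigma>)"
  shows "(v, l) \<in> gen_ideal (block_pairs R \<pi> h \<mu> \<sigma> x) \<longleftrightarrow>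
     v < l \<and> \<not> splits_at (R_lam R \<pi> h \<mu> \<sigma>) v l x"
proof (cases "v < l")
  case True
  have coord: "x (j, c) \<in> carrier (cyc R \<pi> (\<mu> j))" if "(j, c) \<in> idx h \<sigma>" for j c
    using x that by (auto simp: R_lam_def cyc_sum_sel PiE_iff)
  have "splits_at (R_lam R \<pi> h \<mu> \<sigma>) v l x \<longleftrightarrow>
    (\<forall>(j, c)\<in>idx h \<sigma>. splits_at (cyc R \<pi> (\<mu> j)) v l (x (j, c)))"
    using x unfolding R_lam_def cyc_sum_def
    by (subst splits_at_direct_sum_iff) (auto simp: case_prod_unfold)
  also have "\<dots> \<longleftrightarrow> (\<forall>(j, c)\<in>idx h \<sigma>. \<not> (\<exists>w. qval R \<pi> (x (j, c)) = enat w \<and> w + (l - \<mu> j) \<le> v))"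
    using splits_at_cyc_iff[OF _ True] coord by (intro ball_cong) auto
  finally show ?thesis
    unfolding mem_gen_block_pairs_iff using True by auto
qed (simp add: mem_gen_block_pairs_iff)

text \<open>Serves two purposes: between different decompositions it makes \<open>elt_ideal\<close>
  independent of the choice, and for an automorphism it gives invariance along orbits.\<close>

lemma gen_block_pairs_module_iso:
  assumes "\<phi> \<in> module_iso R (R_lam R \<pi> k lam \<rho>) (R_lam R \<pi> h \<mu> \<sigma>)" "x \<in> carrier (R_lam R \<pi> k lam \<rho>)"
  shows "gen_ideal (block_pairs R \<pi> h \<mu> \<sigma> (\<phi> x)) = gen_ideal (block_pairs R \<pi> k lam \<rho> x)"
proof -
  have "\<phi> x \<in> carrier (R_lam R \<pi> h \<mu> \<sigma>)"
    using assms by (auto simp: module_iso_def iso_def hom_def)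
  moreover have "splits_at (R_lam R \<pi> h \<mu> \<sigma>) v l (\<phi> x) \<longleftrightarrow> splits_at (R_lam R \<pi> k lam \<rho>) v l x" for v l
    using assms by (intro splits_at_module_iso_iff)
      (auto simp: R_lam_def intro!: abelian_group_cyc_sum smult_cyc_sum_closed)
  ultimately show ?thesis
    using assms(2) mem_gen_block_pairs_iff_splits by auto
qed

text \<open>The identity shows that a decomposition exists, so the one picked by \<open>SOME\<close>
  is genuine; invariance carries its ideal back to the standard coordinates.\<close>

lemma elt_ideal_R_lam:
  assumes part: "is_partition k lam \<rho>" and x: "x \<in> carrier (R_lam R \<pi> k lam \<rho>)"
  shows "elt_ideal R \<pi> (R_lam R \<pi> k lam \<rho>) x = gen_ideal (block_pairs R \<pi> k lam \<rho> x)"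
proof -
  let ?D = "\<lambda>(h, \<mu>, \<sigma>, \<phi>). is_decomposition R \<pi> (R_lam R \<pi> k lam \<rho>) h \<mu> \<sigma> \<phi>"
  have inj: "inj_on lam {1..k}"
    using part unfolding is_partition_def inj_on_def by (metis less_irrefl linorder_neqE_nat)
  have "abelian_group (R_lam R \<pi> k lam \<rho>)"
    unfolding R_lam_def by (rule abelian_group_cyc_sum)
  note abelian_monoid.a_closed[OF abelian_group.axioms(1)[OF this], simp]
  have "(\<lambda>x. x) \<in> module_iso R (R_lam R \<pi> k lam \<rho>) (R_lam R \<pi> k lam \<rho>)"
    by (simp add: module_iso_def iso_def hom_def bij_betw_def)
  then have "?D (k, lam, \<rho>, \<lambda>x. x)"
    using part inj by (simp add: is_decomposition_def is_partition_def)
  then have "?D (Eps ?D)"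
    by (rule someI)
  moreover obtain h \<mu> \<sigma> \<phi> where "Eps ?D = (h, \<mu>, \<sigma>, \<phi>)"
    by (metis prod_cases4)
  ultimately show ?thesis
    using gen_block_pairs_module_iso[OF _ x] by (simp add: elt_ideal_def is_decomposition_def)
qed

end

subsection \<open>Valuations of the coordinates of an image\<close>

lemma fund_le_iff: "v < l \<Longrightarrow> fund_le (v, l) (v', l') \<longleftrightarrow> v' + (l - l') \<le> v"
  by (auto simp: fund_le_def)

text \<open>Above \<open>p\<close> the ideal has an element on which a bounded, strictly monotone
  natural-number function is greatest, and such an element is maximal.\<close>

lemma gen_ideal_le_max:
  assumes fin: "finite A" and p: "p \<in> gen_ideal A"
  shows "\<exists>q\<in>max_elts (gen_ideal A). fund_le p q"
proof -
  obtain v l where vl: "p = (v, l)" by fastforce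
  \<comment> \<open>Both summands grow weakly along \<open>fund_le\<close> above \<open>p\<close>,
    where \<open>v' \<le> v\<close> keeps \<open>v - v'\<close> from being truncated; if neither
    grows, the two pairs coincide. The first is bounded by its values on the generators, the second
    by \<open>v\<close>.\<close>
  define f where "f = (\<lambda>(v', l'). (l' - v') + (v - v'))"
  define N where "N = Max ((\<lambda>(v', l'). l' - v') ` A)"
  have "f q < Suc (N + v)" if q: "q \<in> gen_ideal A \<and> fund_le p q" for q
  proof -
    obtain v' l' where q': "q = (v', l')" by fastforce
    obtain v2 l2 where a: "(v2, l2) \<in> A" "fund_le q (v2, l2)" "v' < l'"
      using q unfolding q' by (auto simp: gen_ideal_def fund_poset_def)
    have "l2 - v2 \<le> N"
      unfolding N_def using fin a(1) by (auto intro!: Max_ge)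
    then show ?thesis
      using a(2,3) unfolding f_def q' by (auto simp: fund_le_iff)
  qed
  moreover have "p \<in> gen_ideal A \<and> fund_le p p"
    using p by (auto simp: fund_le_def)
  ultimately obtain q where q: "q \<in> gen_ideal A" "fund_le p q"
    and max: "\<And>q'. q' \<in> gen_ideal A \<Longrightarrow> fund_le p q' \<Longrightarrow> f q' \<le> f q"
    using ex_has_greatest_nat[of "\<lambda>q. q \<in> gen_ideal A \<and> fund_le p q" p f "Suc (N + v)"] by blast
  have "q' = q" if q': "q' \<in> gen_ideal A" "fund_le q q'" for q'
  proof -
    obtain v1 l1 v2 l2 where eq: "q = (v1, l1)" "q' = (v2, l2)" by fastforce
    have lt: "v < l" "v1 < l1" "v2 < l2"
      using p q(1) q'(1) vl eq by (auto simp: gen_ideal_def fund_poset_def)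
    have "fund_le p q'"
      using q(2) q'(2) by (auto simp: fund_le_def)
    then have "f q' \<le> f q" using max q'(1) by blast
    then show ?thesis
      using q(2) q'(2) lt unfolding eq vl f_def by (auto simp: fund_le_iff)
  qed
  then show ?thesis
    using q unfolding max_elts_def by blast
qed

context uniformized_dvr begin

lemma finite_block_pairs: "finite (block_pairs R \<pi> h \<mu> \<sigma> x)"
proof (rule finite_subset)
  show "block_pairs R \<pi> h \<mu> \<sigma> x \<subseteq>
    (\<lambda>i. (the_enat (INF c\<in>{1..\<sigma> i}. qval R \<pi> (x (i, c))), \<mu> i)) ` {1..h}"
  proof
    fix p assume "p \<in> block_pairs R \<pi> h \<mu> \<sigma> x"
    then obtain v i where "i \<in> {1..h}" "p = (v, \<mu> i)" "(INF c\<in>{1..\<sigma> i}. qval R \<pi> (x (i, c))) = enat v"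
      unfolding block_pairs_def by blast
    then show "p \<in> (\<lambda>i. (the_enat (INF c\<in>{1..\<sigma> i}. qval R \<pi> (x (i, c))), \<mu> i)) ` {1..h}"
      by (intro image_eqI) simp_all
  qed
qed simp

text \<open>Holds for whatever tuple \<open>SOME\<close> returns, since \<open>gen_ideal\<close>
  keeps only pairs from \<open>fund_poset\<close>. This covers the quotient module inside
  \<open>bar_ideal\<close>.\<close>

lemma elt_ideal_subset: "elt_ideal R \<pi> M x \<subseteq> fund_poset"
  by (auto simp: elt_ideal_def gen_ideal_def split: prod.splits)

lemma qval_lt:
  assumes "x \<in> carrier (R_lam R \<pi> k lam \<rho>)" "(j, c) \<in> idx k \<rho>" "qval R \<pi> (x (j, c)) = enat w"
  shows "w < lam j"
proof -
  obtain z where "z \<in> carrier R" "x (j, c) = cls R \<pi> (lam j) z"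
    using PiE_mem[OF assms(1)[unfolded R_lam_def cyc_sum_sel] assms(2)] by (auto simp: carrier_cyc)
  then show ?thesis
    using assms(3) by (simp add: qval_cls split: if_splits)
qed

lemma qval_mem_gen_ideal:
  assumes "x \<in> carrier (R_lam R \<pi> k lam \<rho>)" "(j, c) \<in> idx k \<rho>" "qval R \<pi> (x (j, c)) = enat w"
  shows "(w, lam j) \<in> gen_ideal (block_pairs R \<pi> k lam \<rho> x)"
  using qval_lt[OF assms] assms(2,3) by (force simp: mem_gen_block_pairs_iff)

text \<open>Replaces the matrix argument that a map from block \<open>j\<close> to block
  \<open>i\<close> gains the factor \<open>\<pi>\<close> to the power \<open>lam i - lam j\<close>.
  A coordinate of \<open>g x\<close> gives a pair in the ideal of \<open>x\<close>, which must lie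
  below the pair of some coordinate of \<open>x\<close>.\<close>

lemma le_qval_module_iso:
  assumes g: "g \<in> module_iso R (R_lam R \<pi> k lam \<rho>) (R_lam R \<pi> k lam \<rho>)"
    and x: "x \<in> carrier (R_lam R \<pi> k lam \<rho>)" and ic: "(i, c) \<in> idx k \<rho>"
    and le: "\<And>j c. (j, c) \<in> idx k \<rho> \<Longrightarrow> t \<le> qval R \<pi> (x (j, c)) + enat (lam i - lam j)"
  shows "t \<le> qval R \<pi> (g x (i, c))"
proof (cases "qval R \<pi> (g x (i, c))")
  case (enat w)
  have "g x \<in> carrier (R_lam R \<pi> k lam \<rho>)"
    using g x by (auto simp: module_iso_def iso_def hom_def)
  then have "(w, lam i) \<in> gen_ideal (block_pairs R \<pi> k lam \<rho> (g x))"
    using qval_mem_gen_ideal ic enat by blast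
  then obtain j c' w' where j: "(j, c') \<in> idx k \<rho>" "qval R \<pi> (x (j, c')) = enat w'" "w' + (lam i - lam j) \<le> w"
    unfolding gen_block_pairs_module_iso[OF g x] mem_gen_block_pairs_iff by blast
  have "t \<le> enat (w' + (lam i - lam j))"
    using le[OF j(1)] j(2) by simp
  also have "\<dots> \<le> enat w" using j(3) by simp
  finally show ?thesis using enat by simp
qed simp

text \<open>The hypotheses say that \<open>(n, lam i)\<close> is maximal in the ideal of
  \<open>x\<close>. The same ideal belongs to \<open>g x\<close>, and a maximal element can only
  come from a coordinate of \<open>g x\<close> in block \<open>i\<close> itself.\<close>

lemma qval_module_iso_attained:
  assumes part: "is_partition k lam \<rho>"
    and g: "g \<in> module_iso R (R_lam R \<pi> k lam \<rho>) (R_lam R \<pi> k lam \<rho>)"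
    and x: "x \<in> carrier (R_lam R \<pi> k lam \<rho>)" and ic: "(i, c) \<in> idx k \<rho>"
    and n: "qval R \<pi> (x (i, c)) = enat n"
    and le: "\<And>c. (i, c) \<in> idx k \<rho> \<Longrightarrow> enat n \<le> qval R \<pi> (x (i, c))"
    and less: "\<And>j c. (j, c) \<in> idx k \<rho> \<Longrightarrow> j \<noteq> i \<Longrightarrow> enat n < qval R \<pi> (x (j, c)) + enat (lam i - lam j)"
  shows "\<exists>c\<in>{1..\<rho> i}. qval R \<pi> (g x (i, c)) = enat n"
proof -
  have gx: "g x \<in> carrier (R_lam R \<pi> k lam \<rho>)"
    using g x by (auto simp: module_iso_def iso_def hom_def)
  have "(n, lam i) \<in> gen_ideal (block_pairs R \<pi> k lam \<rho> x)"
    using qval_mem_gen_ideal[OF x ic n] .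
  then obtain j c' w where j: "(j, c') \<in> idx k \<rho>" "qval R \<pi> (g x (j, c')) = enat w" "w + (lam i - lam j) \<le> n"
    unfolding gen_block_pairs_module_iso[OF g x, symmetric] mem_gen_block_pairs_iff by blast
  have "j = i"
  proof (rule ccontr)
    assume ji: "j \<noteq> i"
    have neq: "lam j \<noteq> lam i"
      using part ic j(1) ji unfolding is_partition_def idx_def
      by (metis SigmaE fst_conv less_irrefl linorder_neqE_nat)
    have "(w, lam j) \<in> gen_ideal (block_pairs R \<pi> k lam \<rho> (g x))"
      using qval_mem_gen_ideal[OF gx j(1,2)] .
    then obtain h c'' w' where h: "(h, c'') \<in> idx k \<rho>" "qval R \<pi> (x (h, c'')) = enat w'" "w' + (lam j - lam h) \<le> w"
      unfolding gen_block_pairs_module_iso[OF g x] mem_gen_block_pairs_iff by blast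
    \<comment> \<open>The pair \<open>(n, lam i)\<close> lies below \<open>(w, lam j)\<close>, which
      lies below \<open>(w', lam h)\<close>. For \<open>h = i\<close> this forces
      \<open>lam j = lam i\<close>; for any other \<open>h\<close> it contradicts the strict bound
      \<open>less\<close>.\<close>
    show False
    proof (cases "h = i")
      case True
      then show False using le[of c''] h j(3) neq by auto
    next
      case False
      then show False using less[OF h(1)] h(2,3) j(3) by auto
    qed
  qed
  \<comment> \<open>With \<open>j = i\<close> the shift vanishes, so \<open>w \<le> n\<close> is
    known; the bound on images supplies the converse.\<close>
  then have "enat n \<le> enat w"
    using le_qval_module_iso[OF g x j(1), of "enat n"] le less j(2) by (metis add.right_neutral diff_self_eq_0 less_imp_le zero_enat_def)
  then show ?thesis
    using j \<open>j = i\<close> by (auto simp: idx_def)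
qed

section \<open>Divisibility in powers of a cyclic module and reduction to the residue field\<close>

lemma carrier_cyc_power: "carrier (cyc_power R \<pi> n r) = (\<Pi>\<^sub>E c\<in>{1..r}. carrier (cyc R \<pi> n))"
  by (simp add: cyc_power_def direct_sum_def)

lemma abelian_group_cyc_power: "abelian_group (cyc_power R \<pi> n r)"
  unfolding cyc_power_def by (rule abelian_group_direct_sum) (rule abelian_group_cyc)

text \<open>Division is performed coordinate by coordinate. For infinite \<open>t\<close>, where
  \<open>epow\<close> is zero, both sides say that \<open>z\<close> is the zero element.\<close>

lemma pi_mult_cyc_power_iff:
  "z \<in> pi_mult R \<pi> t (cyc_power R \<pi> n r) \<longleftrightarrow>
     z \<in> carrier (cyc_power R \<pi> n r) \<and> (\<forall>c\<in>{1..r}. t \<le> qval R \<pi> (z c))"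
proof
  assume "z \<in> pi_mult R \<pi> t (cyc_power R \<pi> n r)"
  then obtain w where w: "\<And>c. c \<in> {1..r} \<Longrightarrow> w c \<in> carrier (cyc R \<pi> n)"
    "z = (\<lambda>c\<in>{1..r}. epow R \<pi> t \<odot>\<^bsub>cyc R \<pi> n\<^esub> w c)"
  proof -
    assume *: "\<And>w. (\<And>c. c \<in> {1..r} \<Longrightarrow> w c \<in> carrier (cyc R \<pi> n)) \<Longrightarrow>
      z = (\<lambda>c\<in>{1..r}. epow R \<pi> t \<odot>\<^bsub>cyc R \<pi> n\<^esub> w c) \<Longrightarrow> thesis"
    obtain w where "w \<in> (\<Pi>\<^sub>E c\<in>{1..r}. carrier (cyc R \<pi> n))"
      "z = (\<lambda>c\<in>{1..r}. epow R \<pi> t \<odot>\<^bsub>cyc R \<pi> n\<^esub> w c)"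
      using \<open>z \<in> _\<close> by (auto simp: pi_mult_def cyc_power_def direct_sum_def)
    then show thesis
      using *[of w] PiE_mem[of w] by blast
  qed
  have "t \<le> qval R \<pi> (z c)" if "c \<in> {1..r}" for c
  proof -
    have "qval R \<pi> (w c) + t \<le> qval R \<pi> (epow R \<pi> t \<odot>\<^bsub>cyc R \<pi> n\<^esub> w c)"
      using qval_smult[OF epow_closed w(1)[OF that], of t] by (simp add: val_epow)
    then show ?thesis
      using w(2) that by (metis add_increasing i0_lb order.trans order_refl restrict_apply')
  qed
  then show "z \<in> carrier (cyc_power R \<pi> n r) \<and> (\<forall>c\<in>{1..r}. t \<le> qval R \<pi> (z c))"
    using w by (auto simp: carrier_cyc_power intro!: smult_cyc_closed)
next
  assume z: "z \<in> carrier (cyc_power R \<pi> n r) \<and> (\<forall>c\<in>{1..r}. t \<le> qval R \<pi> (z c))"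
  have "\<exists>w\<in>carrier (cyc R \<pi> n). z c = epow R \<pi> t \<odot>\<^bsub>cyc R \<pi> n\<^esub> w" if c: "c \<in> {1..r}" for c
  proof -
    obtain a where a: "a \<in> carrier R" "z c = cls R \<pi> n a"
      using PiE_mem[OF conjunct1[OF z, unfolded carrier_cyc_power] c] by (auto simp: carrier_cyc)
    show ?thesis
    proof (cases "t \<le> val R \<pi> a")
      case True
      then obtain b where "b \<in> carrier R" "a = epow R \<pi> t \<otimes> b"
        using epow_divides a(1) by blast
      then show ?thesis
        using a by (auto simp: carrier_cyc cls_smult)
    next
      \<comment> \<open>Here \<open>t\<close> exceeds the valuation of the representative but not
        the \<open>qval\<close> of its coset, so the coset is zero.\<close>
      case False
      then have "enat n \<le> val R \<pi> a"
        using bspec[OF conjunct2[OF z] c] le_qval_cls_iff[OF a(1), of t n]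
        by (simp add: a(2) min_def split: if_splits)
      then have "z c = epow R \<pi> t \<odot>\<^bsub>cyc R \<pi> n\<^esub> cls R \<pi> n \<zero>"
        using a cls_eq_zero_iff[OF a(1)] by (simp add: cls_smult zero_cyc)
      then show ?thesis by blast
    qed
  qed
  then obtain w where w: "\<And>c. c \<in> {1..r} \<Longrightarrow> w c \<in> carrier (cyc R \<pi> n) \<and> z c = epow R \<pi> t \<odot>\<^bsub>cyc R \<pi> n\<^esub> w c"
    by metis
  have "z = epow R \<pi> t \<odot>\<^bsub>cyc_power R \<pi> n r\<^esub> restrict w {1..r}"
  proof (rule extensionalityI[of _ "{1..r}"])
    show "z \<in> extensional {1..r}"
      using z by (simp add: carrier_cyc_power PiE_def)
    fix c assume "c \<in> {1..r}"
    then show "z c = (epow R \<pi> t \<odot>\<^bsub>cyc_power R \<pi> n r\<^esub> restrict w {1..r}) c"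
      using w by (simp add: cyc_power_def direct_sum_def)
  qed (simp add: cyc_power_def direct_sum_def)
  moreover have "restrict w {1..r} \<in> carrier (cyc_power R \<pi> n r)"
    using w by (auto simp: carrier_cyc_power)
  ultimately show "z \<in> pi_mult R \<pi> t (cyc_power R \<pi> n r)"
    unfolding pi_mult_def by blast
qed

lemma pi_mult_star_cyc_power_iff:
  "z \<in> pi_mult_star R \<pi> j (cyc_power R \<pi> n r) \<longleftrightarrow>
     z \<in> carrier (cyc_power R \<pi> n r) \<and> (\<forall>c\<in>{1..r}. enat j \<le> qval R \<pi> (z c)) \<and>
     (\<exists>c\<in>{1..r}. qval R \<pi> (z c) = enat j)"
proof -
  have "enat j \<le> q \<Longrightarrow> enat (Suc j) \<le> q \<longleftrightarrow> q \<noteq> enat j" for q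
    by (cases q) auto
  then show ?thesis
    by (auto simp: pi_mult_star_def pi_mult_cyc_power_iff)
qed

text \<open>For \<open>n \<ge> 1\<close> the ideal \<open>P 1\<close> absorbs \<open>P n\<close>, so
  the reduction used in \<open>div_reduce\<close> is the class of any representative modulo
  \<open>\<pi>\<close>.\<close>

lemma coset_P1_cls:
  assumes "n \<ge> 1" "x \<in> carrier R"
  shows "PIdl \<pi> <+>\<^bsub>R\<^esub> cls R \<pi> n x = cls R \<pi> 1 x"
proof -
  interpret P1: ideal "P 1" R by (rule ideal_P)
  interpret Pn: ideal "P n" R by (rule ideal_P)
  have "P n \<subseteq> P 1"
  proof
    fix z assume z: "z \<in> P n"
    then have "enat n \<le> val R \<pi> z"
      using in_P_iff_val[OF Pn.Icarr] by blast
    then have "enat 1 \<le> val R \<pi> z"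
      using assms(1) by (meson enat_ord_simps(1) order_trans)
    then show "z \<in> P 1"
      using in_P_iff_val[OF Pn.Icarr[OF z]] by blast
  qed
  have "P 1 <+>\<^bsub>R\<^esub> P n = P 1"
  proof
    show "P 1 <+>\<^bsub>R\<^esub> P n \<subseteq> P 1"
    proof
      fix z assume "z \<in> P 1 <+>\<^bsub>R\<^esub> P n"
      then obtain a b where "a \<in> P 1" "b \<in> P n" "z = a \<oplus> b"
        unfolding set_add_def set_mult_def by auto
      then show "z \<in> P 1"
        using \<open>P n \<subseteq> P 1\<close> P1.a_closed by blast
    qed
    show "P 1 \<subseteq> P 1 <+>\<^bsub>R\<^esub> P n"
    proof
      fix z assume z: "z \<in> P 1"
      then have "z = z \<oplus> \<zero>"
        using P1.Icarr[OF z] by simp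
      moreover have "z \<oplus> \<zero> \<in> P 1 <+>\<^bsub>R\<^esub> P n"
        unfolding set_add_def set_mult_def using z Pn.zero_closed by (fastforce simp del: r_zero nat_pow_eone)
      ultimately show "z \<in> P 1 <+>\<^bsub>R\<^esub> P n"
        by simp
    qed
  qed
  then show ?thesis
    using a_setmult_rcos_assoc[OF P1.a_subset Pn.a_subset assms(2)] by (simp add: cls_def)
qed

text \<open>Lifts the quotient chosen by \<open>SOME\<close> to coefficients \<open>W c\<close> in
  the ring, so that linear independence can be argued by valuations.\<close>

lemma div_reduce_rep:
  assumes z: "z \<in> pi_mult R \<pi> (enat v) (cyc_power R \<pi> n r)" and n: "n \<ge> 1"
  obtains W where "\<And>c. c \<in> {1..r} \<Longrightarrow> W c \<in> carrier R"
    and "\<And>c. c \<in> {1..r} \<Longrightarrow> z c = cls R \<pi> n (\<pi> [^] v \<otimes> W c)"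
    and "\<And>c. c \<in> {1..r} \<Longrightarrow> div_reduce R \<pi> n r v z c = cls R \<pi> 1 (W c)"
proof -
  let ?M = "cyc_power R \<pi> n r"
  define w where "w = (SOME w. w \<in> carrier ?M \<and> \<pi> [^] v \<odot>\<^bsub>?M\<^esub> w = z)"
  have "\<exists>w. w \<in> carrier ?M \<and> \<pi> [^] v \<odot>\<^bsub>?M\<^esub> w = z"
    using z by (auto simp: pi_mult_def epow_def)
  then have "w \<in> carrier ?M \<and> \<pi> [^] v \<odot>\<^bsub>?M\<^esub> w = z"
    unfolding w_def by (rule someI_ex)
  then have w: "w \<in> carrier ?M" "\<pi> [^] v \<odot>\<^bsub>?M\<^esub> w = z"
    by blast+
  from w(1) have "\<forall>c\<in>{1..r}. \<exists>x. x \<in> carrier R \<and> w c = cls R \<pi> n x"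
    unfolding carrier_cyc_power carrier_cyc by (meson PiE_mem imageE)
  then obtain W where W: "\<And>c. c \<in> {1..r} \<Longrightarrow> W c \<in> carrier R \<and> w c = cls R \<pi> n (W c)"
    by metis
  show ?thesis
  proof
    fix c assume c: "c \<in> {1..r}"
    show "W c \<in> carrier R" using W c by blast
    show "z c = cls R \<pi> n (\<pi> [^] v \<otimes> W c)"
      using W[OF c] c by (simp add: w(2)[symmetric] cyc_power_def direct_sum_def cls_smult)
    show "div_reduce R \<pi> n r v z c = cls R \<pi> 1 (W c)"
      using W[OF c] c n coset_P1_cls unfolding div_reduce_def Let_def w_def[symmetric] by simp
  qed
qed

lemma residue_field_sel:
  "carrier (residue_field R \<pi>) = cls R \<pi> 1 ` carrier R"
  "\<zero>\<^bsub>residue_field R \<pi>\<^esub> = cls R \<pi> 1 \<zero>"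
  "x \<in> carrier R \<Longrightarrow> x' \<in> carrier R \<Longrightarrow>
    cls R \<pi> 1 x \<otimes>\<^bsub>residue_field R \<pi>\<^esub> cls R \<pi> 1 x' = cls R \<pi> 1 (x \<otimes> x')"
  "x \<in> carrier R \<Longrightarrow> x' \<in> carrier R \<Longrightarrow>
    cls R \<pi> 1 x \<oplus>\<^bsub>residue_field R \<pi>\<^esub> cls R \<pi> 1 x' = cls R \<pi> 1 (x \<oplus> x')"
  using carrier_cyc[of 1] zero_cyc[of 1] cls_add[of x x' 1] ideal.rcoset_mult_add[OF ideal_P, of x x' 1]
  by (simp_all add: cyc_def Let_def residue_field_def FactRing_def cls_def)

lemma cls_1_eq_zero_iff:
  "x \<in> carrier R \<Longrightarrow> cls R \<pi> 1 x = \<zero>\<^bsub>residue_field R \<pi>\<^esub> \<longleftrightarrow> 1 \<le> val R \<pi> x"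
  using cls_eq_zero_iff[of x 1] by (simp add: residue_field_sel zero_cyc one_enat_def)

text \<open>Coefficients lift to the ring, where a residue vanishes exactly when the valuation is at
  least 1; a linear relation becomes a valuation estimate.\<close>

lemma lin_indep2_residueI:
  assumes W: "\<And>c. c \<in> {1..r} \<Longrightarrow> W c \<in> carrier R" "\<And>c. c \<in> {1..r} \<Longrightarrow> W' c \<in> carrier R"
    and uw: "\<And>c. c \<in> {1..r} \<Longrightarrow> u c = cls R \<pi> 1 (W c)" "\<And>c. c \<in> {1..r} \<Longrightarrow> w c = cls R \<pi> 1 (W' c)"
    and indep: "\<And>a b. a \<in> carrier R \<Longrightarrow> b \<in> carrier R \<Longrightarrow>
      (\<And>c. c \<in> {1..r} \<Longrightarrow> 1 \<le> val R \<pi> (a \<otimes> W c \<oplus> b \<otimes> W' c)) \<Longrightarrow> val R \<pi> a \<noteq> 0 \<and> val R \<pi> b \<noteq> 0"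
  shows "lin_indep2 (residue_field R \<pi>) r u w"
  unfolding lin_indep2_def
proof (intro ballI impI)
  fix \<alpha> \<beta>
  assume "\<alpha> \<in> carrier (residue_field R \<pi>)" "\<beta> \<in> carrier (residue_field R \<pi>)"
    and eq: "\<forall>c\<in>{1..r}. \<alpha> \<otimes>\<^bsub>residue_field R \<pi>\<^esub> u c \<oplus>\<^bsub>residue_field R \<pi>\<^esub>
      \<beta> \<otimes>\<^bsub>residue_field R \<pi>\<^esub> w c = \<zero>\<^bsub>residue_field R \<pi>\<^esub>"
  then obtain a b where ab: "a \<in> carrier R" "b \<in> carrier R" "\<alpha> = cls R \<pi> 1 a" "\<beta> = cls R \<pi> 1 b"
    by (auto simp: residue_field_sel(1))
  have "1 \<le> val R \<pi> (a \<otimes> W c \<oplus> b \<otimes> W' c)" if c: "c \<in> {1..r}" for c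
  proof -
    have "cls R \<pi> 1 (a \<otimes> W c \<oplus> b \<otimes> W' c) = \<zero>\<^bsub>residue_field R \<pi>\<^esub>"
      using bspec[OF eq c] ab W c uw by (simp add: residue_field_sel(3,4) del: One_nat_def)
    then show ?thesis
      using ab W c by (simp add: cls_1_eq_zero_iff del: One_nat_def)
  qed
  then have "val R \<pi> a \<noteq> 0 \<and> val R \<pi> b \<noteq> 0"
    using indep ab by blast
  then show "\<alpha> = \<zero>\<^bsub>residue_field R \<pi>\<^esub> \<and> \<beta> = \<zero>\<^bsub>residue_field R \<pi>\<^esub>"
    using ab by (simp add: cls_1_eq_zero_iff ileI1 one_eSuc del: One_nat_def)
qed

lemma module_iso_add:
  "g \<in> module_iso R N N' \<Longrightarrow> x \<in> carrier N \<Longrightarrow> x' \<in> carrier N \<Longrightarrow> g (x \<oplus>\<^bsub>N\<^esub> x') = g x \<oplus>\<^bsub>N'\<^esub> g x'"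
  by (auto simp: module_iso_def iso_def hom_def)

lemma module_iso_smult:
  "g \<in> module_iso R N N' \<Longrightarrow> a \<in> carrier R \<Longrightarrow> x \<in> carrier N \<Longrightarrow> g (a \<odot>\<^bsub>N\<^esub> x) = a \<odot>\<^bsub>N'\<^esub> g x"
  by (auto simp: module_iso_def)

lemma module_Aut_module_iso:
  "g \<in> carrier (module_Aut R M) \<Longrightarrow> g \<in> module_iso R M M"
  by (auto simp: module_Aut_def AutoGroup_def auto_def Bij_def module_iso_def iso_def)

end

subsection \<open>The pair of a canonical form and a characteristic element\<close>

context uniformized_dvr begin

text \<open>Allows computation with representatives in the domain, where valuations of products add
  exactly; truncation at \<open>lam\<close> enters only on passing to cosets.\<close>

definition of_rep :: "(nat \<Rightarrow> nat) \<Rightarrow> (nat \<times> nat) set \<Rightarrow> (nat \<times> nat \<Rightarrow> 'a) \<Rightarrow> nat \<times> nat \<Rightarrow> 'a set" where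
  "of_rep lam A X = (\<lambda>p\<in>A. cls R \<pi> (lam (fst p)) (X p))"

lemma of_rep_closed: "(\<And>p. X p \<in> carrier R) \<Longrightarrow> of_rep lam A X \<in> carrier (cyc_sum R \<pi> lam A)"
  by (simp add: of_rep_def cyc_sum_sel)

lemma of_rep_add:
  "(\<And>p. X p \<in> carrier R) \<Longrightarrow> (\<And>p. Y p \<in> carrier R) \<Longrightarrow>
    of_rep lam A X \<oplus>\<^bsub>cyc_sum R \<pi> lam A\<^esub> of_rep lam A Y = of_rep lam A (\<lambda>p. X p \<oplus> Y p)"
  by (auto simp: of_rep_def cyc_sum_sel cls_add intro!: restrict_ext)

lemma of_rep_smult:
  "a \<in> carrier R \<Longrightarrow> (\<And>p. X p \<in> carrier R) \<Longrightarrow>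
    a \<odot>\<^bsub>cyc_sum R \<pi> lam A\<^esub> of_rep lam A X = of_rep lam A (\<lambda>p. a \<otimes> X p)"
  by (auto simp: of_rep_def cyc_sum_sel cls_smult intro!: restrict_ext)

lemma val_le_qval_cls: "x \<in> carrier R \<Longrightarrow> val R \<pi> x \<le> qval R \<pi> (cls R \<pi> n x)"
  by (simp add: qval_cls)

lemma le_val_add_shift:
  assumes "x \<in> carrier R" "y \<in> carrier R" "t \<le> val R \<pi> x + n" "t \<le> val R \<pi> y + n"
  shows "t \<le> val R \<pi> (x \<oplus> y) + n"
proof -
  have "min (val R \<pi> x) (val R \<pi> y) \<le> val R \<pi> (x \<oplus> y)"
    using assms by (intro val_add) auto
  then show ?thesis
    using assms(3,4) by (metis add_right_mono min_def order_trans)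
qed

end

lemma le_m_exp_iff:
  "t \<le> m_exp R \<pi> k lam \<rho> S s r y i \<longleftrightarrow>
    (\<forall>j\<in>S. j < i \<longrightarrow> t \<le> enat (s j) + val R \<pi> (y j \<ominus>\<^bsub>R\<^esub> y i)) \<and>
    (\<forall>j\<in>S. j > i \<longrightarrow> t \<le> enat (lam i - lam j) + enat (s j) + val R \<pi> (y j \<ominus>\<^bsub>R\<^esub> y i)) \<and>
    (\<forall>j\<in>S. j < i \<longrightarrow> \<rho> j > 1 \<longrightarrow> t \<le> r j) \<and>
    (\<forall>j\<in>{1..k} - S. j < i \<longrightarrow> t \<le> r j) \<and>
    (\<forall>j\<in>S. j > i \<longrightarrow> \<rho> j > 1 \<longrightarrow> t \<le> enat (lam i - lam j) + r j) \<and>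
    (\<forall>j\<in>{1..k} - S. j > i \<longrightarrow> t \<le> enat (lam i - lam j) + r j)"
  unfolding m_exp_def by (subst Min_ge_iff) (auto simp: le_INF_iff)

text \<open>The orbit of the stabilizer enters through \<open>f_I\<close>, and the description of
  \<open>r\<close> by the ideals \<open>J\<close> and \<open>K\<close> enters through
  \<open>r_less\<close>.\<close>

locale canonical_pair = uniformized_dvr R \<pi> for R (structure) and \<pi> +
  fixes k :: nat and lam \<rho> s :: "nat \<Rightarrow> nat" and S :: "nat set" and I :: "(nat \<times> nat) set"
    and r :: "nat \<Rightarrow> enat" and y :: "nat \<Rightarrow> 'a"
  assumes part: "is_partition k lam \<rho>"
    and S: "S \<subseteq> {1..k}"
    and max_I: "max_elts I = (\<lambda>i. (s i, lam i)) ` S"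
    and r_less: "\<And>i w. r i = enat w \<Longrightarrow> w < lam i"
    and y: "\<And>i. i \<in> S \<Longrightarrow> y i \<in> Units R"
    and f_I: "f_elt R \<pi> k lam \<rho> S s r y \<in> ideal_star R \<pi> (R_lam R \<pi> k lam \<rho>) I"
begin

abbreviation M where "M \<equiv> R_lam R \<pi> k lam \<rho>"
abbreviation of_rep_M where "of_rep_M \<equiv> of_rep lam (idx k \<rho>)"

definition e_rep :: "nat \<times> nat \<Rightarrow> 'a" where
  "e_rep = (\<lambda>(j, c). if j \<in> S \<and> c = 1 then \<pi> [^] s j else \<zero>)"

text \<open>A total function: for \<open>j \<in> S\<close> with \<open>\<rho> j = 1\<close> the
  position 2 lies outside \<open>idx k \<rho>\<close> and disappears in
  \<open>of_rep_M\<close>.\<close>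

definition f_rep :: "nat \<times> nat \<Rightarrow> 'a" where
  "f_rep = (\<lambda>(j, c). if j \<in> S \<and> c = 1 then \<pi> [^] s j \<otimes> y j
     else if c = (if j \<in> S then 2 else 1) then epow R \<pi> (r j) else \<zero>)"

definition u_rep :: "nat \<Rightarrow> nat \<times> nat \<Rightarrow> 'a" where
  "u_rep i p = f_rep p \<ominus> y i \<otimes> e_rep p"

lemma y_closed: "i \<in> S \<Longrightarrow> y i \<in> carrier R"
  using y Units_closed by blast

lemma e_rep_closed: "e_rep p \<in> carrier R"
  by (cases p) (simp add: e_rep_def)

lemma f_rep_closed: "f_rep p \<in> carrier R"
  by (cases p) (simp add: f_rep_def y_closed)

lemma u_rep_closed: "i \<in> S \<Longrightarrow> u_rep i p \<in> carrier R"
  by (simp add: u_rep_def f_rep_closed e_rep_closed y_closed)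

lemma e_eq: "canonical_form R \<pi> k lam \<rho> S s = of_rep_M e_rep"
  by (auto simp: canonical_form_def of_rep_def e_rep_def intro!: restrict_ext)

lemma f_eq: "f_elt R \<pi> k lam \<rho> S s r y = of_rep_M f_rep"
  by (auto simp: f_elt_def char_elt_def of_rep_def f_rep_def idx1_def idx2_def intro!: restrict_ext)

lemma f_eq_u_add:
  assumes "i \<in> S"
  shows "of_rep_M f_rep = of_rep_M (u_rep i) \<oplus>\<^bsub>M\<^esub> (y i \<odot>\<^bsub>M\<^esub> of_rep_M e_rep)"
proof -
  have "f_rep p = u_rep i p \<oplus> y i \<otimes> e_rep p" for p
    using assms f_rep_closed[of p] e_rep_closed[of p] y_closed
    by (simp add: u_rep_def minus_eq a_assoc l_neg)
  then have "f_rep = (\<lambda>p. u_rep i p \<oplus> y i \<otimes> e_rep p)"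
    by (rule ext)
  then have "of_rep_M f_rep = of_rep_M (\<lambda>p. u_rep i p \<oplus> y i \<otimes> e_rep p)"
    by (rule arg_cong)
  then show ?thesis
    unfolding R_lam_def using assms
    by (simp add: of_rep_smult of_rep_add u_rep_closed e_rep_closed y_closed)
qed

lemma I_eq: "I = gen_ideal (block_pairs R \<pi> k lam \<rho> (of_rep_M f_rep))"
  using f_I elt_ideal_R_lam[OF part] by (auto simp: ideal_star_def f_eq)

lemma s_less: "i \<in> S \<Longrightarrow> s i < lam i"
  using max_I unfolding max_elts_def I_eq gen_ideal_def fund_poset_def by blast

lemma lam_inj: "i \<in> {1..k} \<Longrightarrow> j \<in> {1..k} \<Longrightarrow> i \<noteq> j \<Longrightarrow> lam i \<noteq> lam j"
  using part unfolding is_partition_def by (metis less_irrefl linorder_neqE_nat)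

text \<open>Distinct maximal elements of \<open>I\<close> are incomparable, and they belong to
  distinct parts \<open>lam i\<close> and \<open>lam j\<close>.\<close>

lemma s_shift_less:
  assumes "i \<in> S" "j \<in> S" "i \<noteq> j"
  shows "s i < s j + (lam i - lam j)"
proof (rule ccontr)
  assume "\<not> ?thesis"
  then have "fund_le (s i, lam i) (s j, lam j)"
    using s_less[OF assms(1)] by (simp add: fund_le_iff)
  moreover have "(s i, lam i) \<in> max_elts I" "(s j, lam j) \<in> max_elts I"
    using max_I assms by auto
  ultimately have "(s j, lam j) = (s i, lam i)"
    unfolding max_elts_def by blast
  then show False
    using lam_inj assms S by blast
qed

text \<open>The coordinate of \<open>f\<close> in question puts \<open>(w, lam j)\<close> into
  \<open>I\<close>, where it lies below some maximal element \<open>(s h, lam h)\<close>.\<close>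

lemma r_ge:
  assumes "(j, c) \<in> idx k \<rho>" "\<not> (j \<in> S \<and> c = 1)" "c = (if j \<in> S then 2 else 1)" "r j = enat w"
  obtains h where "h \<in> S" "s h + (lam j - lam h) \<le> w"
proof -
  have w: "w < lam j" using assms(4) r_less by blast
  have f: "of_rep_M f_rep \<in> carrier M"
    unfolding R_lam_def using f_rep_closed by (rule of_rep_closed)
  have "qval R \<pi> (of_rep_M f_rep (j, c)) = enat w"
    using assms w by (auto simp: of_rep_def f_rep_def qval_cls val_epow)
  then have "(w, lam j) \<in> I"
    unfolding I_eq using qval_mem_gen_ideal[OF f assms(1)] by blast
  then obtain q where "q \<in> max_elts I" "fund_le (w, lam j) q"
    using gen_ideal_le_max[OF finite_block_pairs] unfolding I_eq by blast
  then show ?thesis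
    using that w unfolding max_I by (auto simp: fund_le_iff)
qed

lemma val_f_rep_ge:
  assumes i: "i \<in> S" and jc: "(j, c) \<in> idx k \<rho>"
  shows "enat (s i) \<le> val R \<pi> (f_rep (j, c)) + enat (lam i - lam j)"
    and "j \<noteq> i \<Longrightarrow> enat (s i) < val R \<pi> (f_rep (j, c)) + enat (lam i - lam j)"
proof -
  have "enat (s i) \<le> val R \<pi> (f_rep (j, c)) + enat (lam i - lam j) \<and>
    (j \<noteq> i \<longrightarrow> enat (s i) < val R \<pi> (f_rep (j, c)) + enat (lam i - lam j))"
  proof -
    consider "j \<in> S" "c = 1" | w where "\<not> (j \<in> S \<and> c = 1)" "c = (if j \<in> S then 2 else 1)" "r j = enat w"
      | "\<not> (j \<in> S \<and> c = 1)" "c = (if j \<in> S then 2 else 1) \<longrightarrow> r j = \<infinity>"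
      by (cases "r j") auto
    then show ?thesis
    proof cases
      case 1
      then have "val R \<pi> (f_rep (j, c)) = enat (s j)"
        using y by (simp add: f_rep_def val_mult y_closed val_pi_pow val_unit)
      then show ?thesis
        using s_shift_less[OF i, of j] 1 by (cases "j = i") auto
    next
      case (2 w)
      then have val: "val R \<pi> (f_rep (j, c)) = enat w"
        by (auto simp: f_rep_def val_epow)
      \<comment> \<open>Shifts add up along \<open>i\<close>, \<open>j\<close>, \<open>h\<close>,
        which reduces the claim to \<open>s_shift_less\<close> when \<open>h \<noteq> i\<close>.
        When \<open>h = i\<close> and \<open>j \<noteq> i\<close>, strictness comes from
        \<open>lam j \<noteq> lam i\<close>.\<close>
      obtain h where h: "h \<in> S" "s h + (lam j - lam h) \<le> w"
        using r_ge[OF jc 2] by blast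
      have "j \<in> {1..k}" using jc by (auto simp: idx_def)
      then have "j \<noteq> i \<Longrightarrow> lam j \<noteq> lam i"
        using lam_inj i S by blast
      then show ?thesis
        using s_shift_less[OF i h(1)] h(2) val by (cases "h = i") auto
    next
      case 3
      then have "val R \<pi> (f_rep (j, c)) = \<infinity>"
        by (auto simp: f_rep_def val_epow)
      then show ?thesis by simp
    qed
  qed
  then show "enat (s i) \<le> val R \<pi> (f_rep (j, c)) + enat (lam i - lam j)"
    "j \<noteq> i \<Longrightarrow> enat (s i) < val R \<pi> (f_rep (j, c)) + enat (lam i - lam j)"
    by auto
qed

lemma val_e_rep_ge:
  assumes i: "i \<in> S"
  shows "enat (s i) \<le> val R \<pi> (e_rep (j, c)) + enat (lam i - lam j)"
    and "j \<noteq> i \<Longrightarrow> enat (s i) < val R \<pi> (e_rep (j, c)) + enat (lam i - lam j)"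
  using s_shift_less[OF i, of j] by (cases "j = i"; auto simp: e_rep_def val_pi_pow)+

lemma idx_first: "i \<in> S \<Longrightarrow> (i, 1) \<in> idx k \<rho>"
  using part S by (auto simp: idx_def is_partition_def)

lemma block_closed:
  assumes "x \<in> carrier M" "i \<in> S"
  shows "block \<rho> i x \<in> carrier (cyc_power R \<pi> (lam i) (\<rho> i))"
proof -
  have "x (i, c) \<in> carrier (cyc R \<pi> (lam i))" if "c \<in> {1..\<rho> i}" for c
    using PiE_mem[OF assms(1)[unfolded R_lam_def cyc_sum_sel], of "(i, c)"] assms(2) S that
    by (auto simp: idx_def)
  then show ?thesis
    by (simp add: block_def carrier_cyc_power)
qed

text \<open>Common to \<open>a\<close> and \<open>b\<close>: the hypotheses make
  \<open>(s i, lam i)\<close> maximal in the ideal of the element represented by \<open>X\<close>,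
  so the valuation \<open>s i\<close> is a lower bound in the image block and is attained
  there.\<close>

lemma block_image_star:
  assumes g: "g \<in> module_iso R M M" and i: "i \<in> S"
    and X: "\<And>p. X p \<in> carrier R"
    and Xi: "val R \<pi> (X (i, 1)) = enat (s i)"
    and le: "\<And>j c. (j, c) \<in> idx k \<rho> \<Longrightarrow> enat (s i) \<le> val R \<pi> (X (j, c)) + enat (lam i - lam j)"
    and less: "\<And>j c. (j, c) \<in> idx k \<rho> \<Longrightarrow> j \<noteq> i \<Longrightarrow> enat (s i) < val R \<pi> (X (j, c)) + enat (lam i - lam j)"
  shows "block \<rho> i (g (of_rep_M X)) \<in> pi_mult_star R \<pi> (s i) (cyc_power R \<pi> (lam i) (\<rho> i))"
proof -
  have x: "of_rep_M X \<in> carrier M"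
    unfolding R_lam_def using X by (rule of_rep_closed)
  have gx: "g (of_rep_M X) \<in> carrier M"
    using g x by (auto simp: module_iso_def iso_def hom_def)
  have q: "val R \<pi> (X p) + n \<le> qval R \<pi> (of_rep_M X p) + n" if "p \<in> idx k \<rho>" for p n
    using that val_le_qval_cls[OF X] by (simp add: of_rep_def add_right_mono)
  have q': "enat (s i) \<le> qval R \<pi> (of_rep_M X (j, c)) + enat (lam i - lam j)" if "(j, c) \<in> idx k \<rho>" for j c
    using le[OF that] q[OF that] by (rule order_trans)
  have "qval R \<pi> (of_rep_M X (i, 1)) = enat (s i)"
    using Xi X s_less[OF i] idx_first[OF i] by (simp add: of_rep_def qval_cls)
  then have "\<exists>c\<in>{1..\<rho> i}. qval R \<pi> (g (of_rep_M X) (i, c)) = enat (s i)"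
  proof (rule qval_module_iso_attained[OF part g x idx_first[OF i]])
    fix c assume "(i, c) \<in> idx k \<rho>"
    then show "enat (s i) \<le> qval R \<pi> (of_rep_M X (i, c))"
      using q'[of i c] by (simp add: zero_enat_def[symmetric])
  next
    fix j c assume "(j, c) \<in> idx k \<rho>" "j \<noteq> i"
    then show "enat (s i) < qval R \<pi> (of_rep_M X (j, c)) + enat (lam i - lam j)"
      using less[of j c] q[of "(j, c)"] by (meson less_le_trans)
  qed
  moreover have "enat (s i) \<le> qval R \<pi> (g (of_rep_M X) (i, c))" if "c \<in> {1..\<rho> i}" for c
    using le_qval_module_iso[OF g x _ q'] i S that by (auto simp: idx_def)
  ultimately show ?thesis
    using block_closed[OF gx i] by (auto simp: pi_mult_star_cyc_power_iff block_def)
qed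

section \<open>The exponents \<open>m_min\<close> and the difference \<open>u_rep\<close>\<close>

abbreviation m_min :: "nat \<Rightarrow> enat" where
  "m_min \<equiv> m_exp R \<pi> k lam \<rho> S s r y"

lemma s_less_m_min:
  assumes i: "i \<in> S"
  shows "enat (s i) < m_min i"
proof -
  \<comment> \<open>The positions where \<open>f\<close> carries \<open>\<pi>\<close> to the power
    \<open>r j\<close>: the second one in a block of \<open>S\<close>, the first one in any other
    block.\<close>
  have idx2: "(j, 2) \<in> idx k \<rho>" if "j \<in> S" "\<rho> j > 1" for j
    using that S by (auto simp: idx_def)
  have idx1: "(j, 1) \<in> idx k \<rho>" if "j \<in> {1..k} - S" for j
    using that part by (auto simp: idx_def is_partition_def)
  have r: "enat (s i) < r j + enat (lam i - lam j)" if "j \<in> S \<and> \<rho> j > 1 \<or> j \<in> {1..k} - S" "j \<noteq> i" for j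
    using that val_f_rep_ge(2)[OF i idx2, of j] val_f_rep_ge(2)[OF i idx1, of j]
    by (auto simp: f_rep_def val_epow)
  have diff: "lam i - lam j = 0" if "j \<in> {1..k}" "j < i" for j
    using part i S that by (auto simp: is_partition_def less_imp_le)
  have s: "enat (s i) < enat (s j) + enat (lam i - lam j) + val R \<pi> (y j \<ominus> y i)" if "j \<in> S" "j \<noteq> i" for j
    using s_shift_less[OF i that(1)] that(2) by (cases "val R \<pi> (y j \<ominus> y i)") auto
  \<comment> \<open>The strict bound is restated with \<open>Suc\<close> so that it can be tested on
    each term. For \<open>j < i\<close> the shift \<open>lam i - lam j\<close> is truncated to
    zero.\<close>
  have "enat (Suc (s i)) \<le> m_min i"
    unfolding le_m_exp_iff
  proof (intro conjI allI ballI impI)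
    fix j assume "j \<in> S" "j < i"
    then show "enat (Suc (s i)) \<le> enat (s j) + val R \<pi> (y j \<ominus> y i)"
      using s[of j] diff[of j] S by (auto simp: Suc_ile_eq)
  next
    fix j assume "j \<in> S" "j > i"
    then show "enat (Suc (s i)) \<le> enat (lam i - lam j) + enat (s j) + val R \<pi> (y j \<ominus> y i)"
      using s[of j] by (auto simp: Suc_ile_eq add.commute)
  next
    fix j assume "j \<in> S" "j < i" "\<rho> j > 1"
    then show "enat (Suc (s i)) \<le> r j"
      using r[of j] diff[of j] S by (auto simp: Suc_ile_eq zero_enat_def[symmetric])
  next
    fix j assume "j \<in> {1..k} - S" "j < i"
    then show "enat (Suc (s i)) \<le> r j"
      using r[of j] diff[of j] by (auto simp: Suc_ile_eq zero_enat_def[symmetric])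
  next
    fix j assume "j \<in> S" "j > i" "\<rho> j > 1"
    then show "enat (Suc (s i)) \<le> enat (lam i - lam j) + r j"
      using r[of j] by (auto simp: Suc_ile_eq add.commute)
  next
    fix j assume "j \<in> {1..k} - S" "j > i"
    then show "enat (Suc (s i)) \<le> enat (lam i - lam j) + r j"
      using r[of j] by (auto simp: Suc_ile_eq add.commute)
  qed
  then show ?thesis by (simp add: Suc_ile_eq)
qed

lemma m_min_le:
  "j \<in> S \<Longrightarrow> j < i \<Longrightarrow> m_min i \<le> enat (s j) + val R \<pi> (y j \<ominus> y i)"
  "j \<in> S \<Longrightarrow> j > i \<Longrightarrow> m_min i \<le> enat (lam i - lam j) + enat (s j) + val R \<pi> (y j \<ominus> y i)"
  "j \<in> S \<Longrightarrow> \<rho> j > 1 \<Longrightarrow> j < i \<Longrightarrow> m_min i \<le> r j"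
  "j \<in> {1..k} - S \<Longrightarrow> j < i \<Longrightarrow> m_min i \<le> r j"
  "j \<in> S \<Longrightarrow> \<rho> j > 1 \<Longrightarrow> j > i \<Longrightarrow> m_min i \<le> enat (lam i - lam j) + r j"
  "j \<in> {1..k} - S \<Longrightarrow> j > i \<Longrightarrow> m_min i \<le> enat (lam i - lam j) + r j"
  using order_refl[of "m_min i"] unfolding le_m_exp_iff by blast+

text \<open>Explains the six terms of \<open>m_min\<close>. A leading coordinate of a block
  \<open>j\<close> of \<open>S\<close> becomes
  \<open>\<pi> [^] s j \<otimes> (y j \<ominus> y i)\<close>; elsewhere \<open>u_rep\<close> agrees
  with \<open>f_rep\<close> and contributes \<open>r j\<close> or zero; \<open>lam i - lam j\<close>
  is the gain on mapping into block \<open>i\<close>.\<close>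

lemma m_min_le_val_u_rep:
  assumes i: "i \<in> S" and jc: "(j, c) \<in> idx k \<rho>" and ji: "j \<noteq> i"
  shows "m_min i \<le> val R \<pi> (u_rep i (j, c)) + enat (lam i - lam j)"
proof -
  have j: "j \<in> {1..k}" "c \<in> {1..\<rho> j}" using jc by (auto simp: idx_def)
  have diff: "lam i - lam j = 0" if "j < i"
    using part i S that j by (auto simp: is_partition_def less_imp_le)
  show ?thesis
  proof (cases "j \<in> S \<and> c = 1")
    case True
    then have "u_rep i (j, c) = \<pi> [^] s j \<otimes> (y j \<ominus> y i)"
      using i y_closed by (simp add: u_rep_def f_rep_def e_rep_def minus_eq r_distr r_minus l_minus m_comm)
    then have "val R \<pi> (u_rep i (j, c)) = enat (s j) + val R \<pi> (y j \<ominus> y i)"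
      using True i y_closed by (simp add: val_mult val_pi_pow)
    then show ?thesis
      using m_min_le(1,2)[of j i] True ji diff
      by (cases j i rule: linorder_cases)
        (auto simp: add_ac zero_enat_def[symmetric] simp del: plus_enat_simps)
  next
    case False
    then have u: "u_rep i (j, c) = f_rep (j, c)"
      using i y_closed f_rep_closed[of "(j, c)"] by (auto simp: u_rep_def e_rep_def minus_eq)
    show ?thesis
    proof (cases "c = (if j \<in> S then 2 else 1)")
      case True
      then have "val R \<pi> (u_rep i (j, c)) = r j"
        using False u by (auto simp: f_rep_def val_epow)
      then show ?thesis
        using m_min_le(3-6)[of j i] True ji diff j
        by (cases j i rule: linorder_cases) (auto simp: add_ac zero_enat_def[symmetric] split: if_splits)
    next
      case ne: False
      then have "val R \<pi> (u_rep i (j, c)) = \<infinity>"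
        using False u by (auto simp: f_rep_def)
      then show ?thesis by simp
    qed
  qed
qed

text \<open>Subtracting \<open>y i\<close> times the canonical form cancels the leading coordinate
  of block \<open>i\<close>, leaving at most the entry at position 2.\<close>

lemma val_u_rep_block:
  assumes i: "i \<in> S"
  shows "val R \<pi> (u_rep i (i, c)) = (if c = 2 then r i else \<infinity>)"
proof (cases "c = 1")
  case True
  then have "u_rep i (i, c) = \<zero>"
    using i y_closed by (simp add: u_rep_def f_rep_def e_rep_def minus_eq m_comm r_neg)
  then show ?thesis using True by simp
next
  case False
  then have "u_rep i (i, c) = f_rep (i, c)"
    using i y_closed f_rep_closed[of "(i, c)"] by (auto simp: u_rep_def e_rep_def minus_eq)
  then show ?thesis using False i by (auto simp: f_rep_def val_epow)
qed

text \<open>The choice \<open>t = m_min i\<close> serves case A and \<open>t = r i\<close> serves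
  case B. If \<open>\<rho> i = 1\<close> there is no second position in the block, hence no
  constraint by \<open>r i\<close>.\<close>

lemma block_image_u:
  assumes g: "g \<in> module_iso R M M" and i: "i \<in> S" and t: "t \<le> m_min i" "\<rho> i > 1 \<Longrightarrow> t \<le> r i"
  shows "block \<rho> i (g (of_rep_M (u_rep i))) \<in> pi_mult R \<pi> t (cyc_power R \<pi> (lam i) (\<rho> i))"
proof -
  have x: "of_rep_M (u_rep i) \<in> carrier M"
    unfolding R_lam_def using u_rep_closed[OF i] by (rule of_rep_closed)
  have gx: "g (of_rep_M (u_rep i)) \<in> carrier M"
    using g x by (auto simp: module_iso_def iso_def hom_def)
  have le: "t \<le> qval R \<pi> (of_rep_M (u_rep i) (j, c)) + enat (lam i - lam j)" if jc: "(j, c) \<in> idx k \<rho>" for j c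
  proof -
    have "t \<le> val R \<pi> (u_rep i (j, c)) + enat (lam i - lam j)"
    proof (cases "j = i")
      case True
      then have "c = 2 \<longrightarrow> \<rho> i > 1" using jc by (auto simp: idx_def)
      then show ?thesis
        using True t(2) val_u_rep_block[OF i] by (auto simp: zero_enat_def[symmetric])
    next
      case False
      then show ?thesis using m_min_le_val_u_rep[OF i jc] t(1) order_trans by blast
    qed
    also have "\<dots> \<le> qval R \<pi> (of_rep_M (u_rep i) (j, c)) + enat (lam i - lam j)"
      using val_le_qval_cls[OF u_rep_closed[OF i]] jc by (simp add: of_rep_def add_right_mono)
    finally show ?thesis .
  qed
  have "t \<le> qval R \<pi> (g (of_rep_M (u_rep i)) (i, c))" if "c \<in> {1..\<rho> i}" for c
    using le_qval_module_iso[OF g x _ le] i S that by (auto simp: idx_def)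
  then show ?thesis
    using block_closed[OF gx i] by (auto simp: pi_mult_cyc_power_iff block_def)
qed

lemma block_diff:
  assumes g: "g \<in> module_iso R M M" and i: "i \<in> S"
  shows "block \<rho> i (g (of_rep_M f_rep)) \<ominus>\<^bsub>cyc_power R \<pi> (lam i) (\<rho> i)\<^esub>
      (y i \<odot>\<^bsub>cyc_power R \<pi> (lam i) (\<rho> i)\<^esub> block \<rho> i (g (of_rep_M e_rep))) =
    block \<rho> i (g (of_rep_M (u_rep i)))" (is "?b \<ominus>\<^bsub>?B\<^esub> ?ya = ?d")
proof -
  have closed: "of_rep_M (u_rep i) \<in> carrier M" "of_rep_M e_rep \<in> carrier M"
    unfolding R_lam_def using u_rep_closed[OF i] e_rep_closed by (auto intro: of_rep_closed)
  then have sm: "y i \<odot>\<^bsub>M\<^esub> of_rep_M e_rep \<in> carrier M"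
    unfolding R_lam_def using smult_cyc_sum_closed y_closed[OF i] by blast
  have img: "g x \<in> carrier M" if "x \<in> carrier M" for x
    using g that by (auto simp: module_iso_def iso_def hom_def)
  have gf: "g (of_rep_M f_rep) = g (of_rep_M (u_rep i)) \<oplus>\<^bsub>M\<^esub> (y i \<odot>\<^bsub>M\<^esub> g (of_rep_M e_rep))"
    unfolding f_eq_u_add[OF i] using g closed sm y_closed[OF i]
    by (simp add: module_iso_add module_iso_smult)
  have sub: "(i, c) \<in> idx k \<rho>" if "c \<in> {1..\<rho> i}" for c
    using that i S by (auto simp: idx_def)
  have b: "?b = ?d \<oplus>\<^bsub>?B\<^esub> ?ya"
    unfolding gf using sub
    by (auto simp: block_def R_lam_def cyc_sum_sel cyc_power_def direct_sum_def intro!: restrict_ext)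
  interpret B: abelian_group ?B by (rule abelian_group_cyc_power)
  have d: "?d \<in> carrier ?B"
    using closed img block_closed i by blast
  have ya: "?ya \<in> carrier ?B"
    using block_closed[OF img[OF closed(2)] i] y_closed[OF i]
    by (auto simp: cyc_power_def direct_sum_def PiE_mem intro!: smult_cyc_closed)
  show ?thesis
    unfolding b using d ya by (simp add: B.minus_eq B.a_assoc B.r_neg)
qed

text \<open>A dependence with coefficients \<open>a\<close>, \<open>b\<close> is tested on a
  combination \<open>X\<close> whose first two entries in block \<open>i\<close> have valuations
  \<open>val b + n\<close> and \<open>val a + n\<close>. If \<open>a\<close> or \<open>b\<close>
  were a unit, valuation \<open>n\<close> would survive in the image, against the
  dependence.\<close>

lemma block_image_u_lin_indep:
  assumes g: "g \<in> module_iso R M M" and i: "i \<in> S"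
    and n: "r i = enat n" "enat n < m_min i" "\<rho> i > 1"
  shows "lin_indep2 (residue_field R \<pi>) (\<rho> i)
    (div_reduce R \<pi> (lam i) (\<rho> i) n (block \<rho> i (g (of_rep_M (u_rep i)))))
    (div_reduce R \<pi> (lam i) (\<rho> i) (s i) (block \<rho> i (g (of_rep_M e_rep))))"
proof -
  let ?u = "of_rep_M (u_rep i)" and ?e = "of_rep_M e_rep"
  have lam: "lam i \<ge> 1" using s_less[OF i] by simp
  have closed: "?u \<in> carrier M" "?e \<in> carrier M"
    unfolding R_lam_def using u_rep_closed[OF i] e_rep_closed by (auto intro: of_rep_closed)
  have "block \<rho> i (g ?u) \<in> pi_mult R \<pi> (enat n) (cyc_power R \<pi> (lam i) (\<rho> i))"
    using n by (intro block_image_u[OF g i]) auto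
  then obtain W where W: "\<And>c. c \<in> {1..\<rho> i} \<Longrightarrow> W c \<in> carrier R"
    "\<And>c. c \<in> {1..\<rho> i} \<Longrightarrow> block \<rho> i (g ?u) c = cls R \<pi> (lam i) (\<pi> [^] n \<otimes> W c)"
    "\<And>c. c \<in> {1..\<rho> i} \<Longrightarrow> div_reduce R \<pi> (lam i) (\<rho> i) n (block \<rho> i (g ?u)) c = cls R \<pi> 1 (W c)"
    using div_reduce_rep[OF _ lam] by metis
  have "block \<rho> i (g ?e) \<in> pi_mult_star R \<pi> (s i) (cyc_power R \<pi> (lam i) (\<rho> i))"
    using i e_rep_closed val_e_rep_ge[OF i]
    by (intro block_image_star[OF g i]) (auto simp: e_rep_def val_pi_pow)
  then obtain W' where W': "\<And>c. c \<in> {1..\<rho> i} \<Longrightarrow> W' c \<in> carrier R"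
    "\<And>c. c \<in> {1..\<rho> i} \<Longrightarrow> block \<rho> i (g ?e) c = cls R \<pi> (lam i) (\<pi> [^] s i \<otimes> W' c)"
    "\<And>c. c \<in> {1..\<rho> i} \<Longrightarrow> div_reduce R \<pi> (lam i) (\<rho> i) (s i) (block \<rho> i (g ?e)) c = cls R \<pi> 1 (W' c)"
    using div_reduce_rep[OF _ lam] unfolding pi_mult_star_def by (metis DiffD1)
  have i2: "(i, 2) \<in> idx k \<rho>" using n(3) i S by (auto simp: idx_def)
  have "n < lam i" using r_less n(1) by blast
  have "s i \<le> n"
    using val_f_rep_ge(1)[OF i i2] n(1) i by (simp add: f_rep_def val_epow)
  show ?thesis
  proof (rule lin_indep2_residueI[of _ W W'])
    fix a b assume ab: "a \<in> carrier R" "b \<in> carrier R"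
      and dep: "\<And>c. c \<in> {1..\<rho> i} \<Longrightarrow> 1 \<le> val R \<pi> (a \<otimes> W c \<oplus> b \<otimes> W' c)"
    \<comment> \<open>The factor lifts the leading entry of \<open>e\<close> from valuation
      \<open>s i\<close> to \<open>n\<close>; \<open>s i \<le> n\<close> makes the difference a
      genuine one.\<close>
    define b' where "b' = b \<otimes> \<pi> [^] (n - s i)"
    define X where "X p = a \<otimes> u_rep i p \<oplus> b' \<otimes> e_rep p" for p
    have b': "b' \<in> carrier R" using ab by (simp add: b'_def)
    have X: "X p \<in> carrier R" for p
      using ab b' u_rep_closed[OF i] e_rep_closed by (simp add: X_def)
    have x: "of_rep_M X \<in> carrier M"
      unfolding R_lam_def using X by (rule of_rep_closed)
    have x_eq: "of_rep_M X = (a \<odot>\<^bsub>M\<^esub> ?u) \<oplus>\<^bsub>M\<^esub> (b' \<odot>\<^bsub>M\<^esub> ?e)"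
      unfolding R_lam_def X_def using ab b' u_rep_closed[OF i] e_rep_closed
      by (simp add: of_rep_smult of_rep_add)
    have gx: "enat (Suc n) \<le> qval R \<pi> (g (of_rep_M X) (i, c)) \<or> qval R \<pi> (g (of_rep_M X) (i, c)) = \<infinity>"
      if c: "c \<in> {1..\<rho> i}" for c
    proof -
      have ic: "(i, c) \<in> idx k \<rho>" using c i S by (auto simp: idx_def)
      have sm: "a \<odot>\<^bsub>M\<^esub> ?u \<in> carrier M" "b' \<odot>\<^bsub>M\<^esub> ?e \<in> carrier M"
        using closed ab(1) b' smult_cyc_sum_closed unfolding R_lam_def by blast+
      have gu: "g ?u (i, c) = cls R \<pi> (lam i) (\<pi> [^] n \<otimes> W c)"
        and ge: "g ?e (i, c) = cls R \<pi> (lam i) (\<pi> [^] s i \<otimes> W' c)"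
        using W(2)[OF c] W'(2)[OF c] c by (simp_all add: block_def)
      have pow: "\<pi> [^] (n - s i) \<otimes> \<pi> [^] s i = \<pi> [^] n"
        using \<open>s i \<le> n\<close> by (simp add: nat_pow_mult)
      have "g (of_rep_M X) = (a \<odot>\<^bsub>M\<^esub> g ?u) \<oplus>\<^bsub>M\<^esub> (b' \<odot>\<^bsub>M\<^esub> g ?e)"
        unfolding x_eq using g closed ab(1) b' sm by (simp add: module_iso_add module_iso_smult)
      then have "g (of_rep_M X) (i, c) = cls R \<pi> (lam i) (a \<otimes> (\<pi> [^] n \<otimes> W c) \<oplus> b' \<otimes> (\<pi> [^] s i \<otimes> W' c))"
        using ic ab(1) b' W(1)[OF c] W'(1)[OF c]
        by (simp add: R_lam_def cyc_sum_sel gu ge cls_smult cls_add)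
      also have "b' \<otimes> (\<pi> [^] s i \<otimes> W' c) = b \<otimes> (\<pi> [^] n \<otimes> W' c)"
        unfolding b'_def pow[symmetric] using ab W'(1)[OF c] by (simp add: m_assoc)
      also have "a \<otimes> (\<pi> [^] n \<otimes> W c) \<oplus> b \<otimes> (\<pi> [^] n \<otimes> W' c) = \<pi> [^] n \<otimes> (a \<otimes> W c \<oplus> b \<otimes> W' c)"
        using ab W(1)[OF c] W'(1)[OF c] by (simp add: r_distr m_lcomm)
      finally have eq: "g (of_rep_M X) (i, c) = cls R \<pi> (lam i) (\<pi> [^] n \<otimes> (a \<otimes> W c \<oplus> b \<otimes> W' c))" .
      have "enat (Suc n) \<le> val R \<pi> (\<pi> [^] n \<otimes> (a \<otimes> W c \<oplus> b \<otimes> W' c))"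
        using dep[OF c] ab W(1)[OF c] W'(1)[OF c]
        by (cases "val R \<pi> (a \<otimes> W c \<oplus> b \<otimes> W' c)") (auto simp: val_mult val_pi_pow one_enat_def)
      then show ?thesis
        unfolding eq using ab W(1)[OF c] W'(1)[OF c] by (simp add: qval_cls)
    qed
    \<comment> \<open>The two coefficients separate: at position 1 the \<open>u\<close> part
      vanishes, at position 2 the \<open>e\<close> part does.\<close>
    have Xi: "val R \<pi> (X (i, 1)) = val R \<pi> b + enat n" "val R \<pi> (X (i, 2)) = val R \<pi> a + enat n"
    proof -
      have "u_rep i (i, 1) = \<zero>" "e_rep (i, 2) = \<zero>" "u_rep i (i, 2) = \<pi> [^] n" "e_rep (i, 1) = \<pi> [^] s i"
        using i y_closed n(1) by (simp_all add: u_rep_def f_rep_def e_rep_def minus_eq m_comm r_neg epow_def)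
      then show "val R \<pi> (X (i, 1)) = val R \<pi> b + enat n" "val R \<pi> (X (i, 2)) = val R \<pi> a + enat n"
        using ab \<open>s i \<le> n\<close> by (simp_all add: X_def b'_def val_mult val_pi_pow add.assoc)
    qed
    \<comment> \<open>Multiplication by \<open>b'\<close> gains at least \<open>n - s i\<close>; the
      bound is needed for \<open>t = n\<close> inside block \<open>i\<close> and for
      \<open>t = Suc n\<close> outside it.\<close>
    have b'e: "enat t \<le> val R \<pi> (b' \<otimes> e_rep p) + q"
      if "enat (t - (n - s i)) \<le> val R \<pi> (e_rep p) + q" for t p q
    proof -
      have "enat t \<le> enat (n - s i) + (val R \<pi> (e_rep p) + q)"
        using that by (cases "val R \<pi> (e_rep p) + q") auto
      also have "\<dots> \<le> val R \<pi> (b' \<otimes> e_rep p) + q"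
        using ab e_rep_closed by (simp add: b'_def val_mult val_pi_pow add.assoc add_increasing)
      finally show ?thesis .
    qed
    have au: "t \<le> val R \<pi> (a \<otimes> u_rep i p) + q" if "t \<le> val R \<pi> (u_rep i p) + q" for t p q
      using that ab u_rep_closed[OF i] by (simp add: val_mult add.assoc add_increasing)
    have le: "enat n \<le> val R \<pi> (X (i, c))" if "(i, c) \<in> idx k \<rho>" for c
      unfolding X_def
    proof (rule val_add)
      show "enat n \<le> val R \<pi> (a \<otimes> u_rep i (i, c))"
        using au[of "enat n" "(i, c)" 0] val_u_rep_block[OF i, of c] n(1) by simp
      show "enat n \<le> val R \<pi> (b' \<otimes> e_rep (i, c))"
        using b'e[of n "(i, c)" 0] val_e_rep_ge(1)[OF i, of i c] \<open>s i \<le> n\<close> by (simp add: zero_enat_def[symmetric])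
    qed (use ab b' u_rep_closed[OF i] e_rep_closed in auto)
    \<comment> \<open>Outside block \<open>i\<close> both parts exceed \<open>n\<close>: the
      \<open>u\<close> part because \<open>n\<close> is below \<open>m_min i\<close>, the
      \<open>e\<close> part because \<open>(s i, lam i)\<close> is maximal.\<close>
    have less: "enat (Suc n) \<le> val R \<pi> (X (j, c)) + enat (lam i - lam j)" if jc: "(j, c) \<in> idx k \<rho>" "j \<noteq> i" for j c
      unfolding X_def
    proof (rule le_val_add_shift)
      have "enat (Suc n) \<le> val R \<pi> (u_rep i (j, c)) + enat (lam i - lam j)"
        using m_min_le_val_u_rep[OF i jc] n(2) by (simp add: Suc_ile_eq)
      then show "enat (Suc n) \<le> val R \<pi> (a \<otimes> u_rep i (j, c)) + enat (lam i - lam j)"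
        by (rule au)
      have "Suc n - (n - s i) = Suc (s i)" using \<open>s i \<le> n\<close> by simp
      then show "enat (Suc n) \<le> val R \<pi> (b' \<otimes> e_rep (j, c)) + enat (lam i - lam j)"
        using b'e[of "Suc n" "(j, c)"] val_e_rep_ge(2)[OF i jc(2), of c] by (simp add: Suc_ile_eq)
    qed (use ab b' u_rep_closed[OF i] e_rep_closed in auto)
    \<comment> \<open>The bounds make \<open>(n, lam i)\<close> maximal as soon as one entry of
      block \<open>i\<close> has valuation \<open>n\<close>; that valuation would then occur in the
      image block, which \<open>gx\<close> excludes.\<close>
    have no: "val R \<pi> (X (i, c)) \<noteq> enat n" if ic: "(i, c) \<in> idx k \<rho>" for c
    proof
      assume "val R \<pi> (X (i, c)) = enat n"
      then have "qval R \<pi> (of_rep_M X (i, c)) = enat n"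
        using X ic \<open>n < lam i\<close> by (simp add: of_rep_def qval_cls)
      then have "\<exists>c\<in>{1..\<rho> i}. qval R \<pi> (g (of_rep_M X) (i, c)) = enat n"
      proof (rule qval_module_iso_attained[OF part g x ic])
        fix c assume "(i, c) \<in> idx k \<rho>"
        then show "enat n \<le> qval R \<pi> (of_rep_M X (i, c))"
          using le[of c] val_le_qval_cls[OF X, of "(i, c)" "lam i"] by (simp add: of_rep_def)
      next
        fix j c assume jc: "(j, c) \<in> idx k \<rho>" "j \<noteq> i"
        have "enat (Suc n) \<le> qval R \<pi> (of_rep_M X (j, c)) + enat (lam i - lam j)"
          using less[OF jc] val_le_qval_cls[OF X, of "(j, c)" "lam j"] jc(1)
          by (simp add: of_rep_def) (meson add_right_mono order_trans)
        then show "enat n < qval R \<pi> (of_rep_M X (j, c)) + enat (lam i - lam j)"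
          by (simp add: Suc_ile_eq)
      qed
      then show False using gx by force
    qed
    show "val R \<pi> a \<noteq> 0 \<and> val R \<pi> b \<noteq> 0"
      using no[OF i2] no[OF idx_first[OF i]] Xi by auto
  qed (use W W' in auto)
qed

end

section \<open>Passage from the orbit hypotheses to \<open>canonical_pair\<close> and the two
  cases\<close>

theorem theorem16:
  fixes R :: "('a, 'b) ring_scheme" and \<pi> :: 'a
    and k :: nat and lam \<rho> s :: "nat \<Rightarrow> nat" and S :: "nat set"
    and I J K :: "(nat \<times> nat) set"
    and e m f :: "nat \<times> nat \<Rightarrow> 'a set"
    and r m_min :: "nat \<Rightarrow> enat" and y :: "nat \<Rightarrow> 'a"
    and M :: "('a, nat \<times> nat \<Rightarrow> 'a set) module"
    and Orb :: "(nat \<times> nat \<Rightarrow> 'a set) set"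
    and PairOrb :: "((nat \<times> nat \<Rightarrow> 'a set) \<times> (nat \<times> nat \<Rightarrow> 'a set)) set"
  assumes "discrete_valuation_ring R" and "uniformizer R \<pi>"
    and "finite (carrier (residue_field R \<pi>))"
    and "is_partition k lam \<rho>"
    and "M = R_lam R \<pi> k lam \<rho>"
    and "I \<in> J_lam k lam" and "S \<subseteq> {1..k}" and "S \<noteq> {}"
    and "max_elts I = (\<lambda>i. (s i, lam i)) ` S"
    and "e = canonical_form R \<pi> k lam \<rho> S s"
    and "m \<in> ideal_star R \<pi> M I"
    and "J = bar_ideal R \<pi> lam S e m"
    and "K = elt_ideal R \<pi> (cyc_sum R \<pi> lam (idx2 k \<rho> S)) (restrict m (idx2 k \<rho> S))"
    and "Orb = stab_orbit R \<pi> k lam \<rho> S (restrict m (idx1 S)) J K"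
    and "Orb \<subseteq> ideal_star R \<pi> M I"
    and "Orb \<in> orbits (stab_group R M e) (ideal_star R \<pi> M I) (\<lambda>g. g)"
    and "r = r_exp lam J K"
    and "\<And>i. i \<in> S \<Longrightarrow> y i \<in> Units R"
    and "f = f_elt R \<pi> k lam \<rho> S s r y"
    and "f \<in> Orb"
    and "PairOrb = {(g e, g f) | g. g \<in> carrier (module_Aut R M)}"
    and "m_min = m_exp R \<pi> k lam \<rho> S s r y"
  shows "\<forall>(a, b)\<in>PairOrb. \<forall>i\<in>S.
    (let B = cyc_power R \<pi> (lam i) (\<rho> i);
         a\<^sub>i = block \<rho> i a;
         b\<^sub>i = block \<rho> i b;
         d = b\<^sub>i \<ominus>\<^bsub>B\<^esub> (y i \<odot>\<^bsub>B\<^esub> a\<^sub>i);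
         case_A = ((m_min i \<le> r i \<and> \<rho> i > 1) \<or> \<rho> i = 1) \<and> d \<in> pi_mult R \<pi> (m_min i) B;
         case_B = m_min i > r i \<and> \<rho> i > 1 \<and> d \<in> pi_mult R \<pi> (r i) B \<and>
           lin_indep2 (residue_field R \<pi>) (\<rho> i)
             (div_reduce R \<pi> (lam i) (\<rho> i) (the_enat (r i)) d)
             (div_reduce R \<pi> (lam i) (\<rho> i) (s i) a\<^sub>i)
     in a\<^sub>i \<in> pi_mult_star R \<pi> (s i) B \<and> b\<^sub>i \<in> pi_mult_star R \<pi> (s i) B \<and>
        m_min i > enat (s i) \<and> (case_A \<or> case_B) \<and> \<not> (case_A \<and> case_B))"
proof -
  interpret dvr: uniformized_dvr R \<pi>
    using assms(1,2) by (simp add: uniformized_dvr_def uniformized_dvr_axioms_def)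
  have JK: "J \<union> K \<subseteq> fund_poset"
    by (simp add: assms(12,13) bar_ideal_def Let_def dvr.elt_ideal_subset)
  interpret canonical_pair R \<pi> k lam \<rho> s S I r y
  proof
    fix i w assume "r i = enat w"
    then have Inf: "(INF v\<in>{v. (v, lam i) \<in> J \<union> K}. enat v) = enat w"
      by (simp add: assms(17) r_exp_def)
    then obtain v where "v \<in> {v. (v, lam i) \<in> J \<union> K}"
      by (force simp: Inf_enat_def split: if_splits)
    \<comment> \<open>A nonempty infimum in \<open>enat\<close> is attained, so a finite
      \<open>r i\<close> is the first entry of a pair in \<open>fund_poset\<close> and hence below
      \<open>lam i\<close>.\<close>
    then have "(INF v\<in>{v. (v, lam i) \<in> J \<union> K}. enat v) \<in> enat ` {v. (v, lam i) \<in> J \<union> K}"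
      by (intro wellorder_InfI[OF imageI])
    then have "(w, lam i) \<in> J \<union> K"
      using Inf by auto
    then show "w < lam i"
      using JK by (auto simp: fund_poset_def)
  next
    show "f_elt R \<pi> k lam \<rho> S s r y \<in> ideal_star R \<pi> (R_lam R \<pi> k lam \<rho>) I"
      using assms(5,15,19,20) by blast
  qed (use assms in auto)
  show ?thesis
  proof (intro ballI, clarify)
    fix a b i assume "(a, b) \<in> PairOrb" and i: "i \<in> S"
    then obtain g where g: "g \<in> carrier (module_Aut R M)" "a = g e" "b = g f"
      using assms(21) by blast
    have iso: "g \<in> module_iso R (R_lam R \<pi> k lam \<rho>) (R_lam R \<pi> k lam \<rho>)"
      using g(1) dvr.module_Aut_module_iso assms(5) by blast
    let ?B = "cyc_power R \<pi> (lam i) (\<rho> i)"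
    define d where "d = block \<rho> i (g (of_rep_M (u_rep i)))"
    have ab: "a = g (of_rep_M e_rep)" "b = g (of_rep_M f_rep)"
      using g(2,3) assms(10,19) e_eq f_eq by auto
    have d_eq: "block \<rho> i b \<ominus>\<^bsub>?B\<^esub> (y i \<odot>\<^bsub>?B\<^esub> block \<rho> i a) = d"
      unfolding d_def ab by (rule block_diff[OF iso i])
    have a_star: "block \<rho> i a \<in> pi_mult_star R \<pi> (s i) ?B"
      unfolding ab using i e_rep_closed val_e_rep_ge[OF i]
      by (intro block_image_star[OF iso i]) (auto simp: e_rep_def dvr.val_pi_pow)
    have b_star: "block \<rho> i b \<in> pi_mult_star R \<pi> (s i) ?B"
      unfolding ab using i f_rep_closed val_f_rep_ge[OF i] y y_closed
      by (intro block_image_star[OF iso i])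
        (auto simp: f_rep_def dvr.val_pi_pow dvr.val_mult dvr.val_unit)
    have m: "m_min i > enat (s i)"
      using s_less_m_min[OF i] assms(22) by simp
    have \<rho>: "\<rho> i \<ge> 1"
      using assms(4,7) i by (auto simp: is_partition_def)
    have A: "d \<in> pi_mult R \<pi> (m_min i) ?B" if "m_min i \<le> r i \<or> \<rho> i = 1"
      unfolding d_def assms(22) using that assms(22) by (intro block_image_u[OF iso i]) auto
    have B: "d \<in> pi_mult R \<pi> (r i) ?B \<and> lin_indep2 (residue_field R \<pi>) (\<rho> i)
        (div_reduce R \<pi> (lam i) (\<rho> i) (the_enat (r i)) d)
        (div_reduce R \<pi> (lam i) (\<rho> i) (s i) (block \<rho> i a))" if gt: "r i < m_min i" "\<rho> i > 1"
    proof -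
      \<comment> \<open>Lying strictly below \<open>m_min i\<close>, the exponent is finite, so
        \<open>the_enat\<close> returns its actual value.\<close>
      obtain n where "r i = enat n" using gt(1) by (cases "r i") auto
      then show ?thesis
        unfolding d_def ab using gt assms(22) block_image_u[OF iso i, of "r i"]
          block_image_u_lin_indep[OF iso i, of n] by simp
    qed
    show "let B = ?B; a\<^sub>i = block \<rho> i a; b\<^sub>i = block \<rho> i b; d = b\<^sub>i \<ominus>\<^bsub>B\<^esub> (y i \<odot>\<^bsub>B\<^esub> a\<^sub>i);
         case_A = ((m_min i \<le> r i \<and> \<rho> i > 1) \<or> \<rho> i = 1) \<and> d \<in> pi_mult R \<pi> (m_min i) B;
         case_B = m_min i > r i \<and> \<rho> i > 1 \<and> d \<in> pi_mult R \<pi> (r i) B \<and>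
           lin_indep2 (residue_field R \<pi>) (\<rho> i)
             (div_reduce R \<pi> (lam i) (\<rho> i) (the_enat (r i)) d)
             (div_reduce R \<pi> (lam i) (\<rho> i) (s i) a\<^sub>i)
     in a\<^sub>i \<in> pi_mult_star R \<pi> (s i) B \<and> b\<^sub>i \<in> pi_mult_star R \<pi> (s i) B \<and>
        m_min i > enat (s i) \<and> (case_A \<or> case_B) \<and> \<not> (case_A \<and> case_B)"
    proof -
      \<comment> \<open>The numerical conditions of A and B are complementary once
        \<open>\<rho> i \<ge> 1\<close>, which gives both existence and exclusiveness of the
        case.\<close>
      consider "\<rho> i = 1" | "\<rho> i > 1" "m_min i \<le> r i" | "\<rho> i > 1" "r i < m_min i"
        using \<rho> by (cases "\<rho> i = 1"; cases "r i < m_min i") auto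
      then show ?thesis
        unfolding Let_def d_eq by cases (use a_star b_star m A B in auto)
    qed
  qed
qed

end
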